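(* Let $m\ge 2$, let $\mathcal{H}_1,\mathcal{H}_2$ be nontrivial connected simple $m$-uniform hypergraphs, and let $\mathcal{H}=\mathcal{H}_1(u)\odot\mathcal{H}_2(u)$ be a coalescence of $\mathcal{H}_1$ and $\mathcal{H}_2$ at a vertex $u$. Then for every positive integer $d$, $$\mathrm{Tr}_d(\mathcal{H}_1(u)\odot\mathcal{H}_2(u);[u])=\sum_{d_1+d_2=d}\ \sum_{\substack{t_1\le d_1,\ t_2\le d_2\\ 0<t_1+t_2}}\frac{d}{t_1+t_2}\binom{t_1+t_2}{t_1}\,\frac{t_1}{d_1}\,\mathrm{Tr}_{d_1;t_1}(\mathcal{H}_1;[u])\,\frac{t_2}{d_2}\,\mathrm{Tr}_{d_2;t_2}(\mathcal{H}_2;[u]),$$ where $d_1,d_2,t_1,t_2$ range over nonnegative integers.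
   Context: An $m$-uniform hypergraph $\mathcal{H}=(V,E)$ has a finite vertex set $V$ and an edge set $E$ of $m$-element subsets of $V$ (no repeated edges); it is nontrivial if it has more than one vertex. The coalescence $\mathcal{H}_1(v_1)\odot\mathcal{H}_2(v_2)$ of two disjoint hypergraphs is obtained by identifying a vertex $v_1$ of $\mathcal{H}_1$ with a vertex $v_2$ of $\mathcal{H}_2$ to form a new vertex $u$; it is also written $\mathcal{H}_1(u)\odot\mathcal{H}_2(u)$. Let $\mathcal{H}$ be an $m$-uniform hypergraph on $n$ vertices, with a fixed total order on its vertices (for a coalescence, take the induced orders on $\mathcal{H}_1$ and $\mathcal{H}_2$). For an edge $e$ and $v\in e$, write $e(v)$ for the edge $e$ with root $v$. For $d\ge1$ let $\mathcal{F}_d(\mathcal{H})$ be the set of sequences $F=(e_1(v_1),\ldots,e_d(v_d))$ with $e_i\in E(\mathcal{H})$, $v_i\in e_i$ and $v_1\le\cdots\le v_d$ (repetitions allowed; edges with the same root may appear in any order, and different orders give different sequences). Let $R(F)$ be the directed multigraph that is the union, with multiplicities, of the stars $S_{e_i}(v_i)$, $i=1,\dots,d$, where $S_{e_i}(v_i)$ has vertex set $e_i$ and one arc $(v_i,w)$ for each $w\in e_i\setminus\{v_i\}$; its vertex set $V(F)$ is $\bigcup_i e_i$. Let $\mathcal{F}^{\epsilon}_d(\mathcal{H})$ be the set of $F\in\mathcal{F}_d(\mathcal{H})$ such that $R(F)$ is Eulerian (it has a closed directed walk traversing each arc exactly once). For $F\in\mathcal{F}^{\epsilon}_d(\mathcal{H})$,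 let $r_F(v)$ be the number of indices $i$ with $v_i=v$; let $d_F^+(v)=(m-1)r_F(v)$ be the outdegree of $v$ in $R(F)$; and let $\tau(F)$ be the number of arborescences of $R(F)$ with a fixed root $x$ (spanning trees in which every vertex other than $x$ has a directed path to $x$, parallel arcs being distinguished), which does not depend on $x$ since $R(F)$ is Eulerian. Put $$\omega(F)=d(m-1)^n\frac{\tau(F)}{\prod_{v\in V(F)}d_F^+(v)}.$$ For a vertex $u$ and $1\le t\le d$ define $$\mathrm{Tr}_d(\mathcal{H};[u])=\sum_{F\in\mathcal{F}^{\epsilon}_d(\mathcal{H}),\ r_F(u)>0}\omega(F),\qquad \mathrm{Tr}_{d;t}(\mathcal{H};[u])=\sum_{F\in\mathcal{F}^{\epsilon}_d(\mathcal{H}),\ r_F(u)=t}\omega(F).$$ Conventions: $\frac00:=1$ and $\mathrm{Tr}_{0;0}(\mathcal{H};[u]):=(m-1)^{n-1}$ when $\mathcal{H}$ has $n$ vertices. A term with $t_i=0$ and $d_i>0$ is zero because of the factor $t_i/d_i=0$. *)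

theory Defs
  imports Complex_Main "Graph_Theory.Euler"
begin

section \<open>Uniform hypergraphs and coalescence\<close>

record 'a hypergraph =
  hverts :: "'a set"
  hedges :: "'a set set"

text \<open>Edges form a set of vertex sets, so there are no repeated edges.\<close>

definition uniform_hypergraph :: "nat \<Rightarrow> 'a hypergraph \<Rightarrow> bool" where
  "uniform_hypergraph m H \<longleftrightarrow>
     finite (hverts H) \<and> (\<forall>e\<in>hedges H. e \<subseteq> hverts H \<and> card e = m)"

definition hconnected :: "'a hypergraph \<Rightarrow> bool" where
  "hconnected H \<longleftrightarrow>
     (\<forall>x\<in>hverts H. \<forall>y\<in>hverts H. (x, y) \<in> {(a, b). \<exists>e\<in>hedges H. a \<in> e \<and> b \<in> e}\<^sup>*)"

definition nontrivial :: "'a hypergraph \<Rightarrow> bool" where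
  "nontrivial H \<longleftrightarrow> card (hverts H) > 1"

definition replace_vertex :: "'a \<Rightarrow> 'a \<Rightarrow> 'a hypergraph \<Rightarrow> 'a hypergraph" where
  "replace_vertex v u H =
     (let f = id(v := u) in \<lparr>hverts = f ` hverts H, hedges = (\<lambda>e. f ` e) ` hedges H\<rparr>)"

text \<open>
  The coalescence of two disjoint hypergraphs: the vertices \<open>v1\<close> and \<open>v2\<close> are
  identified and the resulting vertex is called \<open>u\<close>. It is only meaningful if \<open>u\<close>
  does not collide with a vertex other than \<open>v1\<close> and \<open>v2\<close>. The hypergraphs
  \<open>replace_vertex v1 u H1\<close> and \<open>replace_vertex v2 u H2\<close> are the copies of
  \<open>H1\<close> and \<open>H2\<close> sitting inside the coalescence and sharing exactly \<open>u\<close>.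
\<close>

definition coalescence ::
  "'a hypergraph \<Rightarrow> 'a \<Rightarrow> 'a hypergraph \<Rightarrow> 'a \<Rightarrow> 'a \<Rightarrow> 'a hypergraph" where
  "coalescence H1 v1 H2 v2 u =
     \<lparr>hverts = hverts (replace_vertex v1 u H1) \<union> hverts (replace_vertex v2 u H2),
      hedges = hedges (replace_vertex v1 u H1) \<union> hedges (replace_vertex v2 u H2)\<rparr>"

section \<open>Sequences of rooted edges\<close>

text \<open>
  The pair \<open>(e, v)\<close> stands for the edge \<open>e\<close> with root \<open>v\<close>; the relation \<open>r\<close> is the
  total order on the vertices (reflexive, i.e. \<open>(v, w) \<in> r\<close> means \<open>v \<le> w\<close>).
\<close>

definition rooted_seqs ::
  "('a \<times> 'a) set \<Rightarrow> nat \<Rightarrow> 'a hypergraph \<Rightarrow> ('a set \<times> 'a) list set" where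
  "rooted_seqs r d H =
     {F. length F = d \<and> (\<forall>(e, v)\<in>set F. e \<in> hedges H \<and> v \<in> e) \<and>
         sorted_wrt (\<lambda>v w. (v, w) \<in> r) (map snd F)}"

text \<open>
  The multigraph \<open>R(F)\<close>: the arc \<open>(i, w)\<close> is the arc from \<open>v\<^sub>i\<close> to \<open>w\<close> of the star of
  the \<open>i\<close>-th rooted edge, so stars are united with multiplicities and parallel arcs
  are distinguished.
\<close>

definition star_graph :: "('a set \<times> 'a) list \<Rightarrow> ('a, nat \<times> 'a) pre_digraph" where
  "star_graph F =
     \<lparr>verts = (\<Union>(e, v)\<in>set F. e),
      arcs = {(i, w). i < length F \<and> w \<in> fst (F ! i) - {snd (F ! i)}},
      tail = (\<lambda>(i, w). snd (F ! i)),
      head = (\<lambda>(i, w). w)\<rparr>"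

definition eulerian :: "('a, 'b) pre_digraph \<Rightarrow> bool" where
  "eulerian G \<longleftrightarrow> (\<exists>u p. pre_digraph.trail G u p u \<and> set p = arcs G)"

definition eulerian_seqs ::
  "('a \<times> 'a) set \<Rightarrow> nat \<Rightarrow> 'a hypergraph \<Rightarrow> ('a set \<times> 'a) list set" where
  "eulerian_seqs r d H = {F \<in> rooted_seqs r d H. eulerian (star_graph F)}"

definition root_count :: "('a set \<times> 'a) list \<Rightarrow> 'a \<Rightarrow> nat" where
  "root_count F v = card {i. i < length F \<and> snd (F ! i) = v}"

lemma out_degree_star_graph:
  assumes "uniform_hypergraph m H" and "F \<in> rooted_seqs r d H"
  shows "out_degree (star_graph F) v = (m - 1) * root_count F v"
proof -
  let ?I = "{i. i < length F \<and> snd (F ! i) = v}"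
  have *: "finite (fst (F ! i) - {v}) \<and> card (fst (F ! i) - {v}) = m - 1" if "i \<in> ?I" for i
  proof -
    have "F ! i \<in> set F" using that by simp
    then have "fst (F ! i) \<in> hedges H \<and> v \<in> fst (F ! i)"
      using assms(2) that by (fastforce simp: rooted_seqs_def case_prod_beta)
    then show ?thesis
      using assms(1) by (auto simp: uniform_hypergraph_def intro: finite_subset)
  qed
  have "out_arcs (star_graph F) v = (SIGMA i:?I. fst (F ! i) - {v})"
    by (auto simp: out_arcs_def star_graph_def)
  then have "out_degree (star_graph F) v = (\<Sum>i\<in>?I. card (fst (F ! i) - {v}))"
    using * by (simp add: out_degree_def card_SigmaI)
  also have "\<dots> = (\<Sum>i\<in>?I. m - 1)"
    using * by (intro sum.cong) auto
  finally show ?thesis by (simp add: root_count_def)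
qed

section \<open>Arborescences\<close>

text \<open>
  The constants \<open>forest\<close> and \<open>tree\<close> of Graph\_Theory only exclude directed cycles. Here
  a tree is a digraph whose underlying undirected multigraph is a tree, so cycles are
  taken in the underlying multigraph: arcs may be traversed in either direction, a loop
  is a cycle of length 1 and two parallel or antiparallel arcs form a cycle of length 2.
\<close>

definition undirected_cycle :: "('a, 'b) pre_digraph \<Rightarrow> 'a list \<Rightarrow> 'b list \<Rightarrow> bool" where
  "undirected_cycle G vs p \<longleftrightarrow>
     p \<noteq> [] \<and> length vs = length p \<and> distinct vs \<and> distinct p \<and> set p \<subseteq> arcs G \<and>
     (\<forall>i<length p. {tail G (p ! i), head G (p ! i)} = {vs ! i, vs ! (Suc i mod length p)})"

definition underlying_tree :: "('a, 'b) pre_digraph \<Rightarrow> bool" where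
  "underlying_tree G \<longleftrightarrow>
     Digraph_Component.connected G \<and> (\<nexists>vs p. undirected_cycle G vs p)"

definition arborescences :: "('a, 'b) pre_digraph \<Rightarrow> 'a \<Rightarrow> ('a, 'b) pre_digraph set" where
  "arborescences G x =
     {T. spanning T G \<and> underlying_tree T \<and> (\<forall>v\<in>verts G. v \<noteq> x \<longrightarrow> v \<rightarrow>\<^sup>*\<^bsub>T\<^esub> x)}"

text \<open>
  An arbitrary fixed root is chosen; for an Eulerian \<open>star_graph F\<close> the number does
  not depend on it.
\<close>

definition tau :: "('a set \<times> 'a) list \<Rightarrow> nat" where
  "tau F = card (arborescences (star_graph F) (SOME x. x \<in> verts (star_graph F)))"

section \<open>Traces at a vertex\<close>

definition omega :: "nat \<Rightarrow> nat \<Rightarrow> ('a set \<times> 'a) list \<Rightarrow> real" where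
  "omega m n F =
     real (length F) * real (m - 1) ^ n *
       (real (tau F) / (\<Prod>v\<in>verts (star_graph F). real (out_degree (star_graph F) v)))"

definition Tr :: "nat \<Rightarrow> ('a \<times> 'a) set \<Rightarrow> nat \<Rightarrow> 'a hypergraph \<Rightarrow> 'a \<Rightarrow> real" where
  "Tr m r d H u =
     (\<Sum>F \<in> {F \<in> eulerian_seqs r d H. root_count F u > 0}. omega m (card (hverts H)) F)"

text \<open>
  The first case is the convention for \<open>d = t = 0\<close>. The quantity is only of interest for
  this case and for \<open>1 \<le> t \<le> d\<close>.
\<close>

definition Tr_at :: "nat \<Rightarrow> ('a \<times> 'a) set \<Rightarrow> nat \<Rightarrow> nat \<Rightarrow> 'a hypergraph \<Rightarrow> 'a \<Rightarrow> real" where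
  "Tr_at m r d t H u =
     (if d = 0 \<and> t = 0 then real (m - 1) ^ (card (hverts H) - 1)
      else (\<Sum>F \<in> {F \<in> eulerian_seqs r d H. root_count F u = t}. omega m (card (hverts H)) F))"

text \<open>The quotient \<open>t / d\<close> with the convention \<open>0 / 0 = 1\<close>.\<close>

definition quot1 :: "nat \<Rightarrow> nat \<Rightarrow> real" where
  "quot1 t d = (if t = 0 \<and> d = 0 then 1 else real t / real d)"

end

theory Submission
  imports Defs
begin

text \<open>
  Since \<open>u\<close> is a cut vertex of the coalescence, a sequence \<open>F\<close> with \<open>u \<in> V(F)\<close> splits into its
  restrictions \<open>F1\<close>, \<open>F2\<close> to the two hypergraphs, and \<open>R(F)\<close> is connected and balanced iff \<open>R(F1)\<close>
  and \<open>R(F2)\<close> are, each being empty or passing through \<open>u\<close>; the balance at \<open>u\<close> follows from the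
  balance at all other vertices. Arborescences rooted at \<open>u\<close> are unions of arborescences of the
  two parts, so up to the factor belonging to \<open>u\<close> the weight \<open>\<omega>\<close> is multiplicative. Finally, the
  sequences with given restrictions are the sorted interleavings of \<open>F1\<close> and \<open>F2\<close>, and only the
  entries with root \<open>u\<close> can be interleaved freely, which gives the binomial coefficient.

  Independence of \<open>\<tau>(F)\<close> from the root is the Markov chain tree theorem: the number of spanning
  in-trees, as a function of the root, is harmonic on a balanced digraph, hence constant on a
  strongly connected one by the maximum principle.
\<close>

section \<open>In-trees and unicycles\<close>

text \<open>The weight \<open>omega\<close> is not multiplicative as it stands: the out-degree of
  \<open>u\<close> is \<open>(m - 1) * r_F(u)\<close>, and root counts at \<open>u\<close> add.
  Dividing \<open>omega\<close> by \<open>d / r_F(u)\<close> repairs precisely this: the count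
  leaves the denominator, and its companion \<open>m - 1\<close> lowers the exponent from
  \<open>n\<close> to \<open>n - 1\<close>, which is additive because the coalescence has
  \<open>n1 + n2 - 1\<close> vertices. This is the origin of \<open>d / (t1 + t2)\<close> and of the
  quotients \<open>t_i / d_i\<close>, and it turns the convention for \<open>d = t = 0\<close> into
  the weight of the empty sequence. That sequence is not Eulerian, so admissibility has to be
  extended to it. Harmonicity comes from a double count of arc sets whose only cycle passes through
  \<open>x\<close>: the cycle is cut at the arc leaving \<open>x\<close> or at the arc entering it.
  The arcs of \<open>R(F)\<close> carry list positions, and restricting \<open>F\<close> renumbers
  them, so the star graph of a part is only isomorphic to a subgraph of \<open>R(F)\<close>. Hence
  trees are arc sets with the tail and head maps as parameters.\<close>

definition arc_rel :: "('b \<Rightarrow> 'a) \<Rightarrow> ('b \<Rightarrow> 'a) \<Rightarrow> 'b set \<Rightarrow> ('a \<times> 'a) set" where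
  "arc_rel t h B = (\<lambda>a. (t a, h a)) ` B"

lemma arc_rel_iff: "(v, w) \<in> arc_rel t h B \<longleftrightarrow> (\<exists>a\<in>B. t a = v \<and> h a = w)"
  by (auto simp: arc_rel_def)

lemma arc_rel_mono: "B \<subseteq> C \<Longrightarrow> arc_rel t h B \<subseteq> arc_rel t h C"
  by (auto simp: arc_rel_def)

lemma arc_rel_rtrancl_mono:
  "(v, w) \<in> (arc_rel t h B)\<^sup>* \<Longrightarrow> B \<subseteq> C \<Longrightarrow> (v, w) \<in> (arc_rel t h C)\<^sup>*"
  using arc_rel_mono rtrancl_mono by (metis subsetD)

text \<open>One arc out of every vertex but the root, together with reachability of the root,
  replaces acyclicity. As plain arc sets, trees on the two sides of a cut vertex are combined by
  union and recovered by intersection.\<close>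

definition in_trees :: "'a set \<Rightarrow> 'b set \<Rightarrow> ('b \<Rightarrow> 'a) \<Rightarrow> ('b \<Rightarrow> 'a) \<Rightarrow> 'a \<Rightarrow> 'b set set" where
  "in_trees V A t h x =
     {B. B \<subseteq> A \<and> (\<forall>v\<in>V - {x}. \<exists>!a. a \<in> B \<and> t a = v) \<and> (\<forall>a\<in>B. t a \<noteq> x) \<and>
         (\<forall>v\<in>V. (v, x) \<in> (arc_rel t h B)\<^sup>*)}"

lemma in_treesI:
  assumes "B \<subseteq> A" "\<And>v. v \<in> V \<Longrightarrow> v \<noteq> x \<Longrightarrow> \<exists>!a. a \<in> B \<and> t a = v" "\<And>a. a \<in> B \<Longrightarrow> t a \<noteq> x"
    "\<And>v. v \<in> V \<Longrightarrow> (v, x) \<in> (arc_rel t h B)\<^sup>*"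
  shows "B \<in> in_trees V A t h x"
  using assms unfolding in_trees_def by blast

lemma in_treesD:
  assumes "B \<in> in_trees V A t h x"
  shows "B \<subseteq> A" "\<And>v. v \<in> V \<Longrightarrow> v \<noteq> x \<Longrightarrow> \<exists>!a. a \<in> B \<and> t a = v" "\<And>a. a \<in> B \<Longrightarrow> t a \<noteq> x"
    "\<And>v. v \<in> V \<Longrightarrow> (v, x) \<in> (arc_rel t h B)\<^sup>*"
  using assms unfolding in_trees_def by blast+

text \<open>Stop at the first visit to \<open>x\<close>: the induction restarts with the empty walk
  whenever it meets \<open>x\<close>.\<close>

lemma rtrancl_avoid_out_arcs:
  assumes "(v, x) \<in> (arc_rel t h C)\<^sup>*"
  shows "(v, x) \<in> (arc_rel t h {a \<in> C. t a \<noteq> x})\<^sup>*"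
  using assms
proof (induction rule: converse_rtrancl_induct)
  case (step v w)
  then obtain a where a: "a \<in> C" "t a = v" "h a = w" by (auto simp: arc_rel_iff)
  show ?case
  proof (cases "v = x")
    case False
    then have "(v, w) \<in> arc_rel t h {a \<in> C. t a \<noteq> x}" using a by (auto simp: arc_rel_iff)
    then show ?thesis using step.IH by (rule converse_rtrancl_into_rtrancl)
  qed auto
qed auto

text \<open>The mirror image: the walk starts afresh at its last visit to \<open>x\<close>.\<close>

lemma rtrancl_avoid_in_arcs:
  assumes "(x, v) \<in> (arc_rel t h C)\<^sup>*"
  shows "(x, v) \<in> (arc_rel t h {a \<in> C. h a \<noteq> x})\<^sup>*"
  using assms
proof (induction rule: rtrancl_induct)
  case (step v w)
  then obtain a where a: "a \<in> C" "t a = v" "h a = w" by (auto simp: arc_rel_iff)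
  show ?case
  proof (cases "w = x")
    case False
    then have "(v, w) \<in> arc_rel t h {a \<in> C. h a \<noteq> x}" using a by (auto simp: arc_rel_iff)
    with step.IH show ?thesis by (rule rtrancl_into_rtrancl)
  qed auto
qed auto

text \<open>For arcs inside \<open>V\<close>, following the unique arc out of each vertex leads to
  \<open>x\<close> and from there back to \<open>x\<close>: a functional digraph whose only cycle
  passes through \<open>x\<close>.\<close>

definition unicycles :: "'a set \<Rightarrow> 'b set \<Rightarrow> ('b \<Rightarrow> 'a) \<Rightarrow> ('b \<Rightarrow> 'a) \<Rightarrow> 'a \<Rightarrow> 'b set set" where
  "unicycles V A t h x =
     {C. C \<subseteq> A \<and> (\<forall>v\<in>V. \<exists>!a. a \<in> C \<and> t a = v) \<and> (\<forall>v\<in>V. (v, x) \<in> (arc_rel t h C)\<^sup>*)}"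

lemma unicyclesI:
  assumes "C \<subseteq> A" "\<And>v. v \<in> V \<Longrightarrow> \<exists>!a. a \<in> C \<and> t a = v" "\<And>v. v \<in> V \<Longrightarrow> (v, x) \<in> (arc_rel t h C)\<^sup>*"
  shows "C \<in> unicycles V A t h x"
  using assms unfolding unicycles_def by blast

lemma unicyclesD:
  assumes "C \<in> unicycles V A t h x"
  shows "C \<subseteq> A" "\<And>v. v \<in> V \<Longrightarrow> \<exists>!a. a \<in> C \<and> t a = v" "\<And>v. v \<in> V \<Longrightarrow> (v, x) \<in> (arc_rel t h C)\<^sup>*"
  using assms unfolding unicycles_def by blast+

text \<open>Reachability of \<open>t a\<close> from \<open>x\<close> puts \<open>a\<close> on the
  cycle. A walk to \<open>t a\<close>, stopped at its first visit there, does not use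
  \<open>a\<close>, the only arc leaving \<open>t a\<close>.\<close>

lemma unicycle_remove:
  assumes "C \<in> unicycles V A t h x" "a \<in> C" "x \<in> V"
    and "(x, t a) \<in> (arc_rel t h C)\<^sup>*" "t a \<in> V"
  shows "C - {a} \<in> in_trees V A t h (t a)"
proof -
  note C = unicyclesD[OF assms(1)]
  have eq: "{b \<in> C. t b \<noteq> t a} = C - {a}"
    using C(2) assms by blast
  have "(v, t a) \<in> (arc_rel t h (C - {a}))\<^sup>*" if "v \<in> V" for v
  proof -
    have "(v, t a) \<in> (arc_rel t h C)\<^sup>*"
      using C(3) that assms(4) by (blast intro: rtrancl_trans)
    from rtrancl_avoid_out_arcs[OF this] show ?thesis by (simp add: eq)
  qed
  moreover have "\<exists>!b. b \<in> C - {a} \<and> t b = v" if "v \<in> V - {t a}" for v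
    using C(2) that by blast
  moreover have "C - {a} \<subseteq> A" "\<forall>b\<in>C - {a}. t b \<noteq> t a"
    using C(1) eq by auto
  ultimately show ?thesis
    by (intro in_treesI) blast+
qed

text \<open>Reachability of \<open>x\<close> from \<open>h a\<close> is the common form of two
  situations: \<open>t a = x\<close>, where the tree itself leads back to \<open>x\<close>, and
  \<open>h a = x\<close>, where it is trivial.\<close>

lemma unicycle_insert:
  assumes "B \<in> in_trees V A t h (t a)" "a \<in> A" "x \<in> V" "(h a, x) \<in> (arc_rel t h (insert a B))\<^sup>*"
  shows "insert a B \<in> unicycles V A t h x" "a \<notin> B" "(x, t a) \<in> (arc_rel t h (insert a B))\<^sup>*"
proof -
  note B = in_treesD[OF assms(1)]
  show "a \<notin> B" using B(3) by auto
  have *: "(v, t a) \<in> (arc_rel t h (insert a B))\<^sup>*" if "v \<in> V" for v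
    using B(4) that by (auto intro: arc_rel_rtrancl_mono)
  then show "(x, t a) \<in> (arc_rel t h (insert a B))\<^sup>*" using assms by simp
  have "(t a, h a) \<in> arc_rel t h (insert a B)" by (auto simp: arc_rel_iff)
  then have "(t a, x) \<in> (arc_rel t h (insert a B))\<^sup>*"
    using assms(4) by (rule converse_rtrancl_into_rtrancl)
  then have "(v, x) \<in> (arc_rel t h (insert a B))\<^sup>*" if "v \<in> V" for v
    using *[OF that] by auto
  moreover have "\<exists>!b. b \<in> insert a B \<and> t b = v" if "v \<in> V" for v
  proof (cases "v = t a")
    case True
    with B(3) show ?thesis by (intro ex1I[of _ a]) auto
  next
    case False
    then have "b \<in> insert a B \<and> t b = v \<longleftrightarrow> b \<in> B \<and> t b = v" for b by auto
    then show ?thesis using B(2)[OF that False] by simp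
  qed
  moreover have "insert a B \<subseteq> A" using B(1) assms(2) by blast
  ultimately show "insert a B \<in> unicycles V A t h x" by (intro unicyclesI)
qed

text \<open>The arc leaving \<open>x\<close> is determined by the unicycle, and removing it leaves a
  tree rooted at \<open>x\<close> whichever arc it was; hence a product.\<close>

lemma card_unicycles_out:
  assumes "finite A" "h ` A \<subseteq> V" "x \<in> V"
  shows "card (unicycles V A t h x) = card {a \<in> A. t a = x} * card (in_trees V A t h x)"
proof -
  let ?P = "{a \<in> A. t a = x} \<times> in_trees V A t h x"
  let ?f = "\<lambda>(a, B). insert a B"
  have *: "insert a B \<in> unicycles V A t h x \<and> a \<notin> B" if "(a, B) \<in> ?P" for a B
  proof -
    have "h a \<in> V" using that assms by auto
    then have "(h a, x) \<in> (arc_rel t h (insert a B))\<^sup>*"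
      using that in_treesD(4)[of B V A t h x "h a"] by (auto intro: arc_rel_rtrancl_mono)
    then show ?thesis using unicycle_insert[of B V A t h a x] that assms by auto
  qed
  have tB: "t b \<noteq> x" if "B \<in> in_trees V A t h x" "b \<in> B" for b B
    using in_treesD(3)[OF that] .
  have inj: "inj_on ?f ?P"
  proof (rule inj_onI)
    fix p q assume p: "p \<in> ?P" and q: "q \<in> ?P" and f: "?f p = ?f q"
    obtain a B a' B' where pq: "p = (a, B)" "q = (a', B')" by (cases p, cases q)
    have eq: "insert a B = insert a' B'" and "t a = x" "t a' = x"
      and B: "B \<in> in_trees V A t h x" "B' \<in> in_trees V A t h x"
      using p q f pq by simp_all
    then have "a = a'" using tB by (metis insert_iff)
    moreover have "a \<notin> B" "a' \<notin> B'" using *[OF p[unfolded pq]] *[OF q[unfolded pq]] by blast+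
    ultimately show "p = q" using pq eq by (metis insert_ident)
  qed
  have im: "?f ` ?P = unicycles V A t h x"
  proof
    show "?f ` ?P \<subseteq> unicycles V A t h x" using * by auto
    show "unicycles V A t h x \<subseteq> ?f ` ?P"
    proof
      fix C assume C: "C \<in> unicycles V A t h x"
      then obtain a where a: "a \<in> C" "t a = x" using unicyclesD(2)[OF C] assms by blast
      have "C - {a} \<in> in_trees V A t h x"
        using unicycle_remove[OF C a(1)] a assms by auto
      moreover have "a \<in> A" using a unicyclesD(1)[OF C] by blast
      ultimately have "(a, C - {a}) \<in> ?P" using a by auto
      moreover have "?f (a, C - {a}) = C" using a by auto
      ultimately show "C \<in> ?f ` ?P" using image_eqI[of C ?f "(a, C - {a})"] by simp
    qed
  qed
  have "card (unicycles V A t h x) = card ?P" using card_image[OF inj] im by simp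
  then show ?thesis by (simp add: card_cartesian_product)
qed

lemma in_trees_finite: "finite A \<Longrightarrow> finite (in_trees V A t h x)"
  by (rule finite_subset[of _ "Pow A"]) (auto simp: in_trees_def)

text \<open>A unicycle through \<open>x\<close> is a tree rooted at the predecessor of \<open>x\<close> on the cycle,
  together with the arc from this predecessor to \<open>x\<close>.\<close>

lemma card_unicycles_in:
  assumes "finite A" "t ` A \<subseteq> V" "h ` A \<subseteq> V" "x \<in> V"
  shows "card (unicycles V A t h x) = (\<Sum>a | a \<in> A \<and> h a = x. card (in_trees V A t h (t a)))"
proof -
  let ?P = "SIGMA a:{a \<in> A. h a = x}. in_trees V A t h (t a)"
  let ?f = "\<lambda>(a, B). insert a B"
  have *: "insert a B \<in> unicycles V A t h x \<and> a \<notin> B \<and> (x, t a) \<in> (arc_rel t h B)\<^sup>*"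
    if "(a, B) \<in> ?P" for a B
    using unicycle_insert[of B V A t h a x] in_treesD(4)[of B V A t h "t a" x] that assms by auto
  have inj: "inj_on ?f ?P"
  proof (rule inj_onI)
    fix p q assume p: "p \<in> ?P" and q: "q \<in> ?P" and f: "?f p = ?f q"
    obtain a B a' B' where pq: "p = (a, B)" "q = (a', B')" by (cases p, cases q)
    have h: "a \<in> A" "a' \<in> A" "h a = x" "h a' = x" "B \<in> in_trees V A t h (t a)"
        "B' \<in> in_trees V A t h (t a')"
      and eq: "insert a B = insert a' B'"
      using p q f pq by simp_all
    define C where "C = insert a B"
    \<comment> \<open>Both candidate arcs enter \<open>x\<close>, so a walk from \<open>x\<close> to
      either tail that does not return to \<open>x\<close> survives in \<open>D\<close>. In
      \<open>D\<close> both tails are sinks, and a functional digraph leads from \<open>x\<close> to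
      at most one sink.\<close>
    define D where "D = C - {a, a'}"
    have C: "C \<in> unicycles V A t h x" using *[of a B] h by (simp add: C_def)
    have uniq: "b = c" if "b \<in> C" "c \<in> C" "t b = t c" for b c
    proof -
      have "t b \<in> V" using that unicyclesD(1)[OF C] assms(2) by blast
      from unicyclesD(2)[OF C this] obtain d where "\<forall>c. c \<in> C \<and> t c = t b \<longrightarrow> c = d" by (elim ex1E)
      then show ?thesis using that by metis
    qed
    have sv: "single_valued (arc_rel t h D)"
    proof (rule single_valuedI)
      fix v w w' assume "(v, w) \<in> arc_rel t h D" "(v, w') \<in> arc_rel t h D"
      then obtain b c where "b \<in> C" "c \<in> C" "t b = v" "h b = w" "t c = v" "h c = w'"
        by (auto simp: D_def arc_rel_iff)
      then show "w = w'" using uniq by auto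
    qed
    have aC: "a \<in> C" "a' \<in> C" using eq by (auto simp: C_def)
    have P: "(x, t b) \<in> (arc_rel t h D)\<^sup>*" if "(b, E) \<in> ?P" "insert b E = C" "b \<in> {a, a'}" for b E
    proof -
      have "(x, t b) \<in> (arc_rel t h {c \<in> E. h c \<noteq> x})\<^sup>*"
        by (rule rtrancl_avoid_in_arcs) (use *[OF that(1)] in simp)
      then show ?thesis
        by (rule arc_rel_rtrancl_mono) (use that h *[OF that(1)] in \<open>auto simp: D_def\<close>)
    qed
    have reach: "(x, t a) \<in> (arc_rel t h D)\<^sup>*" "(x, t a') \<in> (arc_rel t h D)\<^sup>*"
      using P[of a B] P[of a' B'] h eq by (auto simp: C_def)
    have sink: "(t b, w) \<notin> arc_rel t h D" if "b \<in> {a, a'}" for b w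
    proof
      assume "(t b, w) \<in> arc_rel t h D"
      then obtain c where "c \<in> C" "c \<notin> {a, a'}" "t c = t b" by (auto simp: arc_rel_iff D_def)
      with that aC uniq[of c b] show False by auto
    qed
    have "t a = t a'"
      using single_valued_confluent[OF sv reach] sink by (metis converse_rtranclE insertCI)
    then have "a = a'" using uniq aC by blast
    moreover have "a \<notin> B" "a' \<notin> B'" using *[OF p[unfolded pq]] *[OF q[unfolded pq]] by blast+
    ultimately show "p = q" using pq eq by (metis insert_ident)
  qed
  have im: "?f ` ?P = unicycles V A t h x"
  proof
    show "?f ` ?P \<subseteq> unicycles V A t h x" using * by auto
    show "unicycles V A t h x \<subseteq> ?f ` ?P"
    proof
      fix C assume C: "C \<in> unicycles V A t h x"
      then obtain b where b: "b \<in> C" "t b = x" using unicyclesD(2)[OF C] assms by blast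
      have "(x, h b) \<in> arc_rel t h C" using b by (auto simp: arc_rel_iff)
      moreover have "(h b, x) \<in> (arc_rel t h C)\<^sup>*"
        using unicyclesD(1,3)[OF C] b assms by blast
      ultimately have "(x, x) \<in> (arc_rel t h C)\<^sup>+" by simp
      then obtain y where y: "(x, y) \<in> (arc_rel t h C)\<^sup>*" "(y, x) \<in> arc_rel t h C"
        by (metis tranclD2)
      then obtain a where a: "a \<in> C" "t a = y" "h a = x" by (auto simp: arc_rel_iff)
      have aA: "a \<in> A" using a unicyclesD(1)[OF C] by blast
      have "C - {a} \<in> in_trees V A t h (t a)"
        using unicycle_remove[OF C a(1)] a y aA assms by auto
      then have "(a, C - {a}) \<in> ?P" using a aA by auto
      moreover have "?f (a, C - {a}) = C" using a by auto
      ultimately show "C \<in> ?f ` ?P" using image_eqI[of C ?f "(a, C - {a})"] by simp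
    qed
  qed
  have "card (unicycles V A t h x) = card ?P" using card_image[OF inj] im by simp
  also have "\<dots> = (\<Sum>a | a \<in> A \<and> h a = x. card (in_trees V A t h (t a)))"
    by (rule card_SigmaI) (use assms(1) in_trees_finite in auto)
  finally show ?thesis .
qed

lemma card_in_trees_reroot:
  assumes "finite A" "t ` A \<subseteq> V" "h ` A \<subseteq> V" "finite V"
    and balanced: "\<And>v. v \<in> V \<Longrightarrow> card {a \<in> A. h a = v} = card {a \<in> A. t a = v}"
    and strong: "\<And>v w. v \<in> V \<Longrightarrow> w \<in> V \<Longrightarrow> (v, w) \<in> (arc_rel t h A)\<^sup>*"
    and "x \<in> V" "y \<in> V"
  shows "card (in_trees V A t h x) = card (in_trees V A t h y)"
proof -
  define T where "T v = card (in_trees V A t h v)" for v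
  \<comment> \<open>Equate the two counts of unicycles; balance replaces the out-degree by the
    number of summands on the right.\<close>
  have harmonic: "card {a \<in> A. h a = v} * T v = (\<Sum>a | a \<in> A \<and> h a = v. T (t a))" if "v \<in> V" for v
    using card_unicycles_in[OF assms(1-3) that] card_unicycles_out[OF assms(1,3) that, of t]
      balanced[OF that] by (simp add: T_def)
  obtain z where z: "z \<in> V" "\<And>v. v \<in> V \<Longrightarrow> T v \<le> T z"
  proof -
    have "Max (T ` V) \<in> T ` V" using assms by (intro Max_in) auto
    then obtain z where "z \<in> V" "T z = Max (T ` V)" by auto
    then show ?thesis using that[of z] assms by auto
  qed
  \<comment> \<open>The maximum is an average over the arcs entering \<open>h a\<close>, so no term
    may fall below it.\<close>
  have max_pred: "T (t a) = T z" if "a \<in> A" "h a \<in> V" "T (h a) = T z" for a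
  proof (rule ccontr)
    assume ne: "T (t a) \<noteq> T z"
    have le: "T (t b) \<le> T z" if "b \<in> A" for b using that z assms by blast
    have "T (t a) < T z" using le[OF that(1)] ne by simp
    then have "(\<Sum>b | b \<in> A \<and> h b = h a. T (t b)) < (\<Sum>b | b \<in> A \<and> h b = h a. T z)"
      using le that(1) assms(1) by (intro sum_strict_mono_ex1) auto
    then show False using harmonic[OF that(2)] that(3) by simp
  qed
  have "T v = T z" if "v \<in> V" for v
    using strong[OF that z(1)]
  proof (induction rule: converse_rtrancl_induct)
    case (step v w)
    then obtain a where "a \<in> A" "t a = v" "h a = w" by (auto simp: arc_rel_iff)
    then show ?case using max_pred[of a] step.IH assms by auto
  qed simp
  then show ?thesis using assms(7,8) by (simp add: T_def)
qed

section \<open>Gluing in-trees at a shared vertex\<close>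

text \<open>A walk from \<open>V1\<close> can leave \<open>V1\<close> only after it has reached
  \<open>u\<close>, and there it may be stopped. With tails and heads exchanged the same fact treats
  walks that start at \<open>u\<close>.\<close>

lemma arc_rel_rtrancl_restrict:
  assumes "(v, u) \<in> (arc_rel t h B)\<^sup>*" "v \<in> V1"
    and "\<And>a. a \<in> B \<Longrightarrow> t a \<in> V1 \<Longrightarrow> t a \<noteq> u \<Longrightarrow> a \<in> B1 \<and> h a \<in> V1"
  shows "(v, u) \<in> (arc_rel t h B1)\<^sup>*"
proof -
  have "v \<in> V1 \<longrightarrow> (v, u) \<in> (arc_rel t h B1)\<^sup>*"
    using assms(1)
  proof (induction rule: converse_rtrancl_induct)
    case (step v w)
    then obtain a where a: "a \<in> B" "t a = v" "h a = w" by (auto simp: arc_rel_iff)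
    show ?case
    proof (cases "v \<in> V1 \<and> v \<noteq> u")
      case True
      then have "a \<in> B1" "w \<in> V1" using assms(3)[of a] a by auto
      moreover from this have "(v, w) \<in> arc_rel t h B1" using a by (auto simp: arc_rel_iff)
      ultimately show ?thesis using step.IH by (blast intro: converse_rtrancl_into_rtrancl)
    qed auto
  qed simp
  then show ?thesis using assms(2) by simp
qed

lemma in_trees_part:
  assumes "V1 \<inter> V2 = {u}"
    and "t ` A1 \<subseteq> V1" "h ` A1 \<subseteq> V1" "t ` A2 \<subseteq> V2" "h ` A2 \<subseteq> V2"
    and B: "B \<in> in_trees (V1 \<union> V2) (A1 \<union> A2) t h u"
  shows "B \<inter> A1 \<in> in_trees V1 A1 t h u"
proof (rule in_treesI)
  note D = in_treesD[OF B]
  have V1: "a \<in> A1" if "a \<in> B" "t a \<in> V1" "t a \<noteq> u" for a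
    using that D(1) assms by blast
  fix v assume v: "v \<in> V1"
  { assume "v \<noteq> u"
    then have "a \<in> B \<and> t a = v \<longleftrightarrow> a \<in> B \<inter> A1 \<and> t a = v" for a using V1 v by blast
    then show "\<exists>!a. a \<in> B \<inter> A1 \<and> t a = v" using D(2)[of v] v \<open>v \<noteq> u\<close> by simp }
  show "(v, u) \<in> (arc_rel t h (B \<inter> A1))\<^sup>*"
    by (rule arc_rel_rtrancl_restrict[OF D(4) v]) (use v V1 assms in auto)
qed (use in_treesD(3)[OF B] in auto)

lemma in_trees_Un:
  assumes "V1 \<inter> V2 = {u}" "t ` A1 \<subseteq> V1" "t ` A2 \<subseteq> V2"
    and B1: "B1 \<in> in_trees V1 A1 t h u" and B2: "B2 \<in> in_trees V2 A2 t h u"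
  shows "B1 \<union> B2 \<in> in_trees (V1 \<union> V2) (A1 \<union> A2) t h u"
proof (rule in_treesI)
  note D1 = in_treesD[OF B1] and D2 = in_treesD[OF B2]
  show "B1 \<union> B2 \<subseteq> A1 \<union> A2" using D1(1) D2(1) by blast
  fix v assume v: "v \<in> V1 \<union> V2"
  { assume vu: "v \<noteq> u"
    show "\<exists>!a. a \<in> B1 \<union> B2 \<and> t a = v"
    proof (cases "v \<in> V1")
      case True
      then have "a \<in> B1 \<union> B2 \<and> t a = v \<longleftrightarrow> a \<in> B1 \<and> t a = v" for a
        using D2(1) vu assms(1,3) by blast
      then show ?thesis using D1(2)[OF True vu] by simp
    next
      case False
      then have "a \<in> B1 \<union> B2 \<and> t a = v \<longleftrightarrow> a \<in> B2 \<and> t a = v" for a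
        using D1(1) vu assms(1,2) by blast
      then show ?thesis using D2(2)[OF _ vu] False v by simp
    qed }
  show "(v, u) \<in> (arc_rel t h (B1 \<union> B2))\<^sup>*"
    using v
  proof
    assume "v \<in> V1" then show ?thesis by (intro arc_rel_rtrancl_mono[OF D1(4)]) auto
  next
    assume "v \<in> V2" then show ?thesis by (intro arc_rel_rtrancl_mono[OF D2(4)]) auto
  qed
next
  fix a assume "a \<in> B1 \<union> B2" then show "t a \<noteq> u" using in_treesD(3)[OF B1] in_treesD(3)[OF B2] by blast
qed

text \<open>The root \<open>u\<close> has no arc out of it, so a tree chooses arcs only at the other
  vertices, and each of these belongs to exactly one side. This is why the trees have to be rooted
  at the cut vertex.\<close>

lemma card_in_trees_Un:
  assumes V: "V1 \<inter> V2 = {u}" and A: "A1 \<inter> A2 = {}"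
    and 1: "t ` A1 \<subseteq> V1" "h ` A1 \<subseteq> V1" and 2: "t ` A2 \<subseteq> V2" "h ` A2 \<subseteq> V2"
  shows "card (in_trees (V1 \<union> V2) (A1 \<union> A2) t h u) =
    card (in_trees V1 A1 t h u) * card (in_trees V2 A2 t h u)"
proof -
  let ?T = "in_trees (V1 \<union> V2) (A1 \<union> A2) t h u"
  let ?T1 = "in_trees V1 A1 t h u" and ?T2 = "in_trees V2 A2 t h u"
  have "bij_betw (\<lambda>B. (B \<inter> A1, B \<inter> A2)) ?T (?T1 \<times> ?T2)"
  proof (rule bij_betw_byWitness[where f' = "\<lambda>(B1, B2). B1 \<union> B2"])
    show "\<forall>B\<in>?T. (case (B \<inter> A1, B \<inter> A2) of (B1, B2) \<Rightarrow> B1 \<union> B2) = B"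
      using in_treesD(1)[of _ "V1 \<union> V2" "A1 \<union> A2" t h u] by fastforce
    show "\<forall>p\<in>?T1 \<times> ?T2. ((case p of (B1, B2) \<Rightarrow> B1 \<union> B2) \<inter> A1, (case p of (B1, B2) \<Rightarrow> B1 \<union> B2) \<inter> A2) = p"
    proof
      fix p assume "p \<in> ?T1 \<times> ?T2"
      then obtain B1 B2 where "p = (B1, B2)" "B1 \<subseteq> A1" "B2 \<subseteq> A2"
        using in_treesD(1)[of _ V1 A1 t h u] in_treesD(1)[of _ V2 A2 t h u] by (cases p) auto
      then show "((case p of (B1, B2) \<Rightarrow> B1 \<union> B2) \<inter> A1, (case p of (B1, B2) \<Rightarrow> B1 \<union> B2) \<inter> A2) = p"
        using A by auto
    qed
    have V': "V2 \<inter> V1 = {u}" using V by auto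
    show "(\<lambda>B. (B \<inter> A1, B \<inter> A2)) ` ?T \<subseteq> ?T1 \<times> ?T2"
    proof (rule image_subsetI)
      fix B assume B: "B \<in> ?T"
      then have B': "B \<in> in_trees (V2 \<union> V1) (A2 \<union> A1) t h u" by (simp add: Un_commute)
      show "(B \<inter> A1, B \<inter> A2) \<in> ?T1 \<times> ?T2"
        using in_trees_part[OF V 1 2 B] in_trees_part[OF V' 2 1 B'] by simp
    qed
    show "(\<lambda>(B1, B2). B1 \<union> B2) ` (?T1 \<times> ?T2) \<subseteq> ?T"
    proof (rule image_subsetI)
      fix p assume "p \<in> ?T1 \<times> ?T2"
      then show "(case p of (B1, B2) \<Rightarrow> B1 \<union> B2) \<in> ?T"
        using in_trees_Un[OF V 1(1) 2(1)] by (cases p) auto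
    qed
  qed
  then show ?thesis by (simp add: bij_betw_same_card card_cartesian_product)
qed

section \<open>Relabelling of arcs\<close>

lemma ex1_iff_card_1: "(\<exists>!x. P x) \<longleftrightarrow> card {x. P x} = 1"
  unfolding card_1_singleton_iff One_nat_def Ex1_def set_eq_iff mem_Collect_eq singleton_iff by blast

lemma arc_rel_image:
  assumes "\<And>a. a \<in> B \<Longrightarrow> t (f a) = t' a \<and> h (f a) = h' a"
  shows "arc_rel t h (f ` B) = arc_rel t' h' B"
  using assms by (force simp: arc_rel_def)

lemma in_trees_image_iff:
  assumes "inj_on f A" "\<And>a. a \<in> A \<Longrightarrow> t (f a) = t' a \<and> h (f a) = h' a" "B \<subseteq> A"
  shows "f ` B \<in> in_trees V (f ` A) t h x \<longleftrightarrow> B \<in> in_trees V A t' h' x"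
proof -
  have "(\<exists>!b. b \<in> f ` B \<and> t b = v) \<longleftrightarrow> (\<exists>!a. a \<in> B \<and> t' a = v)" for v
  proof -
    \<comment> \<open>Unique existence is read as a fibre of size one, which an injection
      preserves.\<close>
    have "{b \<in> f ` B. t b = v} = f ` {a \<in> B. t' a = v}" using assms by force
    moreover have "inj_on f {a \<in> B. t' a = v}" using assms(1,3) by (auto intro: inj_on_subset)
    ultimately have "card {b \<in> f ` B. t b = v} = card {a \<in> B. t' a = v}" by (simp add: card_image)
    then show ?thesis by (simp add: ex1_iff_card_1)
  qed
  moreover have "arc_rel t h (f ` B) = arc_rel t' h' B"
    using assms by (intro arc_rel_image) auto
  moreover have "f ` B \<subseteq> f ` A" using assms(3) by auto
  moreover have "(\<forall>b\<in>f ` B. t b \<noteq> x) \<longleftrightarrow> (\<forall>a\<in>B. t' a \<noteq> x)"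
    using assms(2)[OF subsetD[OF assms(3)]] by auto
  ultimately show ?thesis using assms(3) by (simp add: in_trees_def)
qed

lemma card_in_trees_image:
  assumes "inj_on f A" "\<And>a. a \<in> A \<Longrightarrow> t (f a) = t' a \<and> h (f a) = h' a"
  shows "card (in_trees V (f ` A) t h x) = card (in_trees V A t' h' x)"
proof -
  have iff: "f ` B \<in> in_trees V (f ` A) t h x \<longleftrightarrow> B \<in> in_trees V A t' h' x" if "B \<subseteq> A" for B
    by (rule in_trees_image_iff) (use assms that in auto)
  have "in_trees V (f ` A) t h x = (\<lambda>B. f ` B) ` in_trees V A t' h' x"
  proof
    show "(\<lambda>B. f ` B) ` in_trees V A t' h' x \<subseteq> in_trees V (f ` A) t h x"
      using iff in_treesD(1)[of _ V A t' h' x] by blast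
    show "in_trees V (f ` A) t h x \<subseteq> (\<lambda>B. f ` B) ` in_trees V A t' h' x"
    proof
      fix B assume B: "B \<in> in_trees V (f ` A) t h x"
      then obtain C where C: "C \<subseteq> A" "B = f ` C" using in_treesD(1) by (metis subset_imageE)
      then show "B \<in> (\<lambda>B. f ` B) ` in_trees V A t' h' x"
        using iff[OF C(1)] B by blast
    qed
  qed
  moreover have "inj_on (\<lambda>B. f ` B) (in_trees V A t' h' x)"
    using assms(1) in_treesD(1)[of _ V A t' h' x]
    by (intro inj_onI) (simp add: inj_on_image_eq_iff)
  ultimately show ?thesis by (simp add: card_image)
qed

section \<open>Arborescences as in-trees\<close>

lemma undirected_path:
  assumes "(x, y) \<in> (arc_rel t h B \<union> (arc_rel t h B)\<inverse>)\<^sup>*"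
  shows "\<exists>vs p. distinct vs \<and> length vs = Suc (length p) \<and> vs ! 0 = x \<and> vs ! length p = y \<and>
    set p \<subseteq> B \<and> (\<forall>i<length p. {t (p ! i), h (p ! i)} = {vs ! i, vs ! Suc i})"
  using assms
proof (induction rule: rtrancl_induct)
  case base
  show ?case by (rule exI[of _ "[x]"], rule exI[of _ "[]"]) simp
next
  case (step y z)
  then obtain vs p where P: "distinct vs" "length vs = Suc (length p)" "vs ! 0 = x" "vs ! length p = y"
    "set p \<subseteq> B" "\<And>i. i < length p \<Longrightarrow> {t (p ! i), h (p ! i)} = {vs ! i, vs ! Suc i}" by blast
  obtain b where b: "b \<in> B" "{t b, h b} = {y, z}" using step.hyps(2) by (auto simp: arc_rel_iff)
  show ?case
  proof (cases "z \<in> set vs")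
    \<comment> \<open>If the new endpoint already lies on the path, the path is cut back to that
      occurrence, which keeps its vertices distinct.\<close>
    case True
    then obtain k where k: "k < length vs" "vs ! k = z" by (auto simp: in_set_conv_nth)
    then have "length (take k p) = k" using P(2) by simp
    then show ?thesis
      by (intro exI[of _ "take (Suc k) vs"] exI[of _ "take k p"])
        (use P k set_take_subset[of k p] in auto)
  next
    case False
    show ?thesis
    proof (rule exI[of _ "vs @ [z]"], rule exI[of _ "p @ [b]"], intro conjI allI impI)
      fix i assume "i < length (p @ [b])"
      then consider "i < length p" | "i = length p" by force
      then show "{t ((p @ [b]) ! i), h ((p @ [b]) ! i)} = {(vs @ [z]) ! i, (vs @ [z]) ! Suc i}"
        by cases (use P b in \<open>auto simp: nth_append\<close>)
    qed (use P b False in \<open>auto simp: nth_append\<close>)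
  qed
qed

lemma undirected_cycleI:
  assumes "B \<subseteq> arcs G" "a \<in> arcs G" "a \<notin> B"
    and "(tail G a, head G a) \<in> (arc_rel (tail G) (head G) B \<union> (arc_rel (tail G) (head G) B)\<inverse>)\<^sup>*"
  shows "\<exists>vs p. undirected_cycle G vs p"
proof -
  obtain vs p where P: "distinct vs" "length vs = Suc (length p)" "vs ! 0 = tail G a" "vs ! length p = head G a"
    "set p \<subseteq> B" "\<And>i. i < length p \<Longrightarrow> {tail G (p ! i), head G (p ! i)} = {vs ! i, vs ! Suc i}"
    using undirected_path[OF assms(4)] by blast
  \<comment> \<open>Distinct vertices force distinct arcs: an arc at positions \<open>i < j\<close>
    would put \<open>vs ! i\<close> among the later vertices \<open>vs ! j\<close> and
    \<open>vs ! Suc j\<close>.\<close>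
  have "distinct p"
  proof -
    have "p ! i \<noteq> p ! j" if "i < j" "j < length p" for i j
    proof
      assume "p ! i = p ! j"
      then have "vs ! i \<in> {vs ! j, vs ! Suc j}" using P(6)[of i] P(6)[of j] that by auto
      then show False using P(1,2) that by (auto simp: nth_eq_iff_index_eq)
    qed
    then show ?thesis unfolding distinct_conv_nth by (metis linorder_neqE_nat)
  qed
  moreover have "{tail G ((p @ [a]) ! i), head G ((p @ [a]) ! i)} =
      {vs ! i, vs ! (Suc i mod length (p @ [a]))}" if "i < length (p @ [a])" for i
  proof (cases "i < length p")
    case True
    then show ?thesis using P(6) by (simp add: nth_append)
  next
    case False
    \<comment> \<open>At the last index the successor wraps around to \<open>0\<close>, so the new
      arc closes the path from its head back to its tail. For a loop the path is empty and the cycle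
      has length one.\<close>
    then have "i = length p" using that by simp
    then show ?thesis using P(3,4) by (auto simp: nth_append)
  qed
  ultimately have "undirected_cycle G vs (p @ [a])"
    unfolding undirected_cycle_def using P(1,2,5) assms(1-3) by auto
  then show ?thesis by blast
qed

text \<open>The least number of steps to \<open>x\<close> is a distance, and the first step of a
  shortest walk lowers it. It is the measure behind both directions of the correspondence with
  arborescences.\<close>

lemma rtrancl_decreasing:
  assumes "(v, x) \<in> R\<^sup>*" "v \<noteq> x"
  obtains w where "(v, w) \<in> R" "(w, x) \<in> R\<^sup>*"
    "(LEAST n. (w, x) \<in> R ^^ n) < (LEAST n. (v, x) \<in> R ^^ n)"
proof -
  define n where "n = (LEAST n. (v, x) \<in> R ^^ n)"
  have "\<exists>n. (v, x) \<in> R ^^ n" using assms(1) by (simp add: rtrancl_power)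
  then have n: "(v, x) \<in> R ^^ n" unfolding n_def by (rule LeastI_ex)
  moreover have "n \<noteq> 0" using n assms(2) by (metis relpow_0_E)
  ultimately obtain k w where k: "n = Suc k" "(v, w) \<in> R" "(w, x) \<in> R ^^ k"
    by (metis not0_implies_Suc relpow_Suc_D2)
  then have "(LEAST n. (w, x) \<in> R ^^ n) < n" using Least_le[of "\<lambda>n. (w, x) \<in> R ^^ n" k] by simp
  then show ?thesis using that k unfolding n_def[symmetric] by (metis relpow_imp_rtrancl)
qed

text \<open>A breadth-first tree: every vertex other than \<open>x\<close> selects an arc that
  decreases the distance to \<open>x\<close>.\<close>

lemma in_tree_exists:
  assumes "\<And>v. v \<in> V \<Longrightarrow> (v, x) \<in> (arc_rel t h B)\<^sup>*" "h ` B \<subseteq> V"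
  shows "\<exists>F. F \<in> in_trees V B t h x"
proof -
  define d where "d v = (LEAST n. (v, x) \<in> arc_rel t h B ^^ n)" for v
  have "\<exists>a. a \<in> B \<and> t a = v \<and> d (h a) < d v" if "v \<in> V" "v \<noteq> x" for v
  proof -
    from assms(1)[OF that(1)] that(2)
    obtain w where "(v, w) \<in> arc_rel t h B" "d w < d v"
      unfolding d_def by (rule rtrancl_decreasing)
    then show ?thesis by (auto simp: arc_rel_iff)
  qed
  then obtain f where f: "\<And>v. v \<in> V \<Longrightarrow> v \<noteq> x \<Longrightarrow> f v \<in> B \<and> t (f v) = v \<and> d (h (f v)) < d v" by metis
  define F where "F = f ` (V - {x})"
  have reach: "v \<in> V \<longrightarrow> (v, x) \<in> (arc_rel t h F)\<^sup>*" for v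
  proof (induction "d v" arbitrary: v rule: less_induct)
    case less
    show ?case
    proof (intro impI, cases "v = x")
      case False
      assume "v \<in> V"
      note fv = f[OF this False]
      have "(v, h (f v)) \<in> arc_rel t h F"
        using fv False \<open>v \<in> V\<close> unfolding arc_rel_iff F_def by blast
      moreover have "(h (f v), x) \<in> (arc_rel t h F)\<^sup>*"
        using less[of "h (f v)"] fv assms(2) by blast
      ultimately show "(v, x) \<in> (arc_rel t h F)\<^sup>*" by (rule converse_rtrancl_into_rtrancl)
    qed simp
  qed
  have "F \<in> in_trees V B t h x"
  proof (rule in_treesI)
    fix v assume v: "v \<in> V"
    show "(v, x) \<in> (arc_rel t h F)\<^sup>*" using reach v by blast
    { assume "v \<noteq> x"
      have "a \<in> F \<and> t a = v \<longleftrightarrow> a = f v" for a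
      proof
        assume "a \<in> F \<and> t a = v"
        moreover from this obtain w where "a = f w" "w \<in> V" "w \<noteq> x" unfolding F_def by blast
        ultimately show "a = f v" using f[of w] by simp
      qed (use f[OF v \<open>v \<noteq> x\<close>] v \<open>v \<noteq> x\<close> in \<open>simp add: F_def\<close>)
      then show "\<exists>!a. a \<in> F \<and> t a = v" by simp }
  next
    show "F \<subseteq> B" unfolding F_def using f by (intro image_subsetI) simp
    fix a assume "a \<in> F"
    then obtain v where "a = f v" "v \<in> V" "v \<noteq> x" unfolding F_def by blast
    then show "t a \<noteq> x" using f[of v] by simp
  qed
  then show ?thesis ..
qed

text \<open>An in-tree inside \<open>arcs T\<close> already joins the two ends of every arc in the
  undirected sense, so any further arc would close a cycle; the in-tree is all of
  \<open>arcs T\<close>.\<close>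

lemma in_trees_of_acyclic:
  assumes "\<And>v. v \<in> V \<Longrightarrow> (v, x) \<in> (arc_rel (tail T) (head T) (arcs T))\<^sup>*"
    and "tail T ` arcs T \<subseteq> V" "head T ` arcs T \<subseteq> V" "\<nexists>vs p. undirected_cycle T vs p"
  shows "arcs T \<in> in_trees V (arcs T) (tail T) (head T) x"
proof -
  obtain F where F: "F \<in> in_trees V (arcs T) (tail T) (head T) x"
    using in_tree_exists[OF assms(1,3)] by blast
  note D = in_treesD[OF F]
  let ?R = "arc_rel (tail T) (head T) F"
  have "arcs T \<subseteq> F"
  proof
    fix a assume a: "a \<in> arcs T"
    then have "(tail T a, x) \<in> ?R\<^sup>*" "(head T a, x) \<in> ?R\<^sup>*"
      using D(4) assms(2,3) by auto
    then have "(tail T a, x) \<in> (?R \<union> ?R\<inverse>)\<^sup>*" "(x, head T a) \<in> (?R \<union> ?R\<inverse>)\<^sup>*"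
      by (auto intro: in_rtrancl_UnI dest: rtrancl_converseI)
    then have "(tail T a, head T a) \<in> (?R \<union> ?R\<inverse>)\<^sup>*" by (rule rtrancl_trans)
    then show "a \<in> F" using undirected_cycleI[OF D(1) a] assms(4) by blast
  qed
  then have "F = arcs T" using D(1) by blast
  then show ?thesis using F by simp
qed

text \<open>Each arc is the only one leaving its tail, hence begins a shortest walk and decreases
  the distance to \<open>x\<close>. At a vertex of a cycle with maximal distance, both incident
  cycle arcs would have to leave it.\<close>

lemma in_trees_acyclic:
  assumes "arcs T \<in> in_trees V A (tail T) (head T) x" "tail T ` arcs T \<subseteq> V"
  shows "\<not> undirected_cycle T vs p"
proof
  assume C: "undirected_cycle T vs p"
  note D = in_treesD[OF assms(1)]
  let ?R = "arc_rel (tail T) (head T) (arcs T)"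
  define d where "d v = (LEAST n. (v, x) \<in> ?R ^^ n)" for v
  have uniq: "a = b" if ab: "a \<in> arcs T" "b \<in> arcs T" "tail T a = tail T b" for a b
  proof -
    have "tail T b \<in> V" "tail T b \<noteq> x" using ab assms(2) D(3) by auto
    from D(2)[OF this] show ?thesis using ab by blast
  qed
  have dec: "d (head T a) < d (tail T a)" if a: "a \<in> arcs T" for a
  proof -
    have "(tail T a, x) \<in> ?R\<^sup>*" "tail T a \<noteq> x" using a assms(2) D(3,4) by auto
    then obtain w where "(tail T a, w) \<in> ?R" "d w < d (tail T a)"
      unfolding d_def by (rule rtrancl_decreasing)
    then obtain b where "b \<in> arcs T" "tail T b = tail T a" "d (head T b) < d (tail T a)"
      by (auto simp: arc_rel_iff)
    then show ?thesis using uniq a by metis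
  qed
  define L where "L = length p"
  have L: "L > 0" "length vs = L" "distinct p" "set p \<subseteq> arcs T"
    "\<And>i. i < L \<Longrightarrow> {tail T (p ! i), head T (p ! i)} = {vs ! i, vs ! (Suc i mod L)}"
    using C by (auto simp: undirected_cycle_def L_def)
  have "Max ((\<lambda>i. d (vs ! i)) ` {..<L}) \<in> (\<lambda>i. d (vs ! i)) ` {..<L}" using L(1) by (intro Max_in) auto
  then obtain i where i: "i < L" "d (vs ! i) = Max ((\<lambda>i. d (vs ! i)) ` {..<L})" by auto
  have max: "d (vs ! j) \<le> d (vs ! i)" if "j < L" for j
    unfolding i(2) using that by (intro Max_ge) auto
  \<comment> \<open>The cyclic predecessor of \<open>i\<close>; for a cycle of length one it is
    \<open>i\<close> itself.\<close>
  define j where "j = (if i = 0 then L - 1 else i - 1)"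
  have j: "j < L" "Suc j mod L = i" using i(1) L(1) by (auto simp: j_def)
  have arcs: "p ! i \<in> arcs T" "p ! j \<in> arcs T" using L(4) i(1) j(1) by (auto simp: L_def)
  have ti: "tail T (p ! i) = vs ! i"
    using L(5)[OF i(1)] dec[OF arcs(1)] max[of "Suc i mod L"] L(1) by (fastforce simp: doubleton_eq_iff)
  have tj: "tail T (p ! j) = vs ! i"
    using L(5)[OF j(1)] dec[OF arcs(2)] max[OF j(1)] j(2) by (fastforce simp: doubleton_eq_iff)
  have "p ! i = p ! j" using uniq arcs ti tj by simp
  then have "i = j" using L(3) i(1) j(1) by (simp add: nth_eq_iff_index_eq L_def)
  \<comment> \<open>An index that is its own cyclic predecessor belongs to a loop, and a loop cannot
    decrease the distance.\<close>
  then have "head T (p ! i) = tail T (p ! i)" using L(5)[OF i(1)] j(2) by (auto simp: doubleton_eq_iff)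
  then show False using dec[OF arcs(1)] by simp
qed

lemma arcs_ends_arc_rel: "arcs_ends G = arc_rel (tail G) (head G) (arcs G)"
  by (simp add: arcs_ends_def arc_to_ends_def arc_rel_def)

lemma (in wf_digraph) connected_if_all_reach:
  assumes "x \<in> verts G" "\<And>v. v \<in> verts G \<Longrightarrow> v \<rightarrow>\<^sup>*\<^bsub>G\<^esub> x"
  shows "Digraph_Component.connected G"
proof -
  interpret S: pair_wf_digraph "mk_symmetric G" ..
  show ?thesis
    unfolding connected_def
  proof (rule strongly_connectedI)
    show "verts (with_proj (mk_symmetric G)) \<noteq> {}" using assms(1) by auto
    fix v w assume "v \<in> verts (with_proj (mk_symmetric G))" "w \<in> verts (with_proj (mk_symmetric G))"
    then have "v \<rightarrow>\<^sup>*\<^bsub>mk_symmetric G\<^esub> x" "w \<rightarrow>\<^sup>*\<^bsub>mk_symmetric G\<^esub> x"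
      using assms(2) reachable_mk_symmetricI by auto
    then show "v \<rightarrow>\<^sup>*\<^bsub>mk_symmetric G\<^esub> w"
      using symmetric_reachable[OF symmetric_mk_symmetric] S.reachable_trans by metis
  qed
qed

text \<open>A spanning subgraph shares vertices, tails and heads with \<open>G\<close>, so it is
  determined by its arc set.\<close>

lemma (in wf_digraph) card_arborescences:
  assumes x: "x \<in> verts G"
  shows "card (arborescences G x) = card (in_trees (verts G) (arcs G) (tail G) (head G) x)"
proof -
  let ?I = "in_trees (verts G) (arcs G) (tail G) (head G) x"
  let ?g = "\<lambda>B. \<lparr>verts = verts G, arcs = B, tail = tail G, head = head G\<rparr>"
  have arb: "arcs T \<in> ?I \<and> ?g (arcs T) = T" if T: "T \<in> arborescences G x" for T
  proof -
    have eq: "verts T = verts G" "tail T = tail G" "head T = head G" and sub: "arcs T \<subseteq> arcs G"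
      and wf: "wf_digraph T"
      and reach: "\<And>v. v \<in> verts G \<Longrightarrow> v \<noteq> x \<Longrightarrow> v \<rightarrow>\<^sup>*\<^bsub>T\<^esub> x"
      and acyc: "\<nexists>vs p. undirected_cycle T vs p"
      using T by (auto simp: arborescences_def spanning_def subgraph_def compatible_def underlying_tree_def)
    have "arcs T \<in> in_trees (verts G) (arcs T) (tail T) (head T) x"
    proof (rule in_trees_of_acyclic[OF _ _ _ acyc])
      fix v assume v: "v \<in> verts G"
      show "(v, x) \<in> (arc_rel (tail T) (head T) (arcs T))\<^sup>*"
      proof (cases "v = x")
        case False
        then show ?thesis
          using reach[OF v False] wf_digraph.reachable_conv'[OF wf] v by (simp add: eq arcs_ends_arc_rel)
      qed simp
    qed (use wf_digraph.wellformed[OF wf] eq in auto)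
    then have "arcs T \<in> ?I" using sub by (simp add: in_trees_def eq)
    moreover have "?g (arcs T) = T" using eq by (cases T) simp
    ultimately show ?thesis ..
  qed
  have tree: "?g B \<in> arborescences G x" if B: "B \<in> ?I" for B
  proof -
    note D = in_treesD[OF B]
    have wf: "wf_digraph (?g B)"
      by unfold_locales (use D(1) in auto)
    have reach: "v \<rightarrow>\<^sup>*\<^bsub>?g B\<^esub> x" if "v \<in> verts G" for v
      using wf_digraph.reachable_conv'[OF wf, of v x] D(4)[OF that] that by (simp add: arcs_ends_arc_rel)
    have "spanning (?g B) G"
      using wf D(1) wf_digraph_axioms by (simp add: spanning_def subgraph_def compatible_def)
    moreover have "underlying_tree (?g B)"
      unfolding underlying_tree_def
    proof
      show "Digraph_Component.connected (?g B)"
        by (rule wf_digraph.connected_if_all_reach[OF wf, of x]) (use x reach in auto)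
      have "tail G ` B \<subseteq> verts G" using D(1) by auto
      then show "\<nexists>vs p. undirected_cycle (?g B) vs p"
        using in_trees_acyclic[of "?g B" "verts G" "arcs G" x] B by simp
    qed
    ultimately show ?thesis using reach by (auto simp: arborescences_def)
  qed
  have "bij_betw arcs (arborescences G x) ?I"
    by (rule bij_betw_byWitness[where f' = ?g]) (use arb tree in auto)
  then show ?thesis by (rule bij_betw_same_card)
qed

section \<open>Eulerian star graphs\<close>

text \<open>Euler's criterion for raw arc sets, so that both parts of \<open>F\<close> can be
  examined inside \<open>star_graph F\<close>. Unlike \<open>eulerian\<close>, it holds for the
  empty graph.\<close>

definition balanced_strong :: "'a set \<Rightarrow> 'b set \<Rightarrow> ('b \<Rightarrow> 'a) \<Rightarrow> ('b \<Rightarrow> 'a) \<Rightarrow> bool" where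
  "balanced_strong V A t h \<longleftrightarrow>
     (\<forall>v\<in>V. card {a \<in> A. h a = v} = card {a \<in> A. t a = v}) \<and>
     (\<forall>v\<in>V. \<forall>w\<in>V. (v, w) \<in> (arc_rel t h A)\<^sup>*)"

lemma card_conv_sum_fibres:
  assumes "finite A" "finite V" "f ` A \<subseteq> V"
  shows "card A = (\<Sum>v\<in>V. card {a \<in> A. f a = v})"
  using sum.group[OF assms, of "\<lambda>_. 1::nat"] by simp

lemma arc_rel_swap: "arc_rel h t A = (arc_rel t h A)\<inverse>"
  by (auto simp: arc_rel_def)

lemma balanced_strong_part:
  assumes fin: "finite A1" "finite V1" and V: "V1 \<inter> V2 \<subseteq> {u}"
    and 1: "t ` A1 \<subseteq> V1" "h ` A1 \<subseteq> V1" and 2: "t ` A2 \<subseteq> V2" "h ` A2 \<subseteq> V2"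
    and bs: "balanced_strong (V1 \<union> V2) (A1 \<union> A2) t h" and u: "u \<in> V1 \<union> V2"
  shows "balanced_strong V1 A1 t h" and "V1 \<noteq> {} \<Longrightarrow> u \<in> V1"
proof -
  have reach: "(v, w) \<in> (arc_rel t h (A1 \<union> A2))\<^sup>*" if "v \<in> V1 \<union> V2" "w \<in> V1 \<union> V2" for v w
    using bs that unfolding balanced_strong_def by blast
  have to_u: "(v, u) \<in> (arc_rel t h A1)\<^sup>*" if "v \<in> V1" for v
    by (rule arc_rel_rtrancl_restrict[OF reach that]) (use that u V 1 2 in auto)
  have from_u: "(u, v) \<in> (arc_rel t h A1)\<^sup>*" if "v \<in> V1" for v
  proof -
    \<comment> \<open>Reversing all arcs reduces walks from \<open>u\<close> to walks towards
      \<open>u\<close>.\<close>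
    have "(v, u) \<in> (arc_rel h t (A1 \<union> A2))\<^sup>*"
      using reach[OF u, of v] that by (simp add: arc_rel_swap[of h t] rtrancl_converse)
    then have "(v, u) \<in> (arc_rel h t A1)\<^sup>*"
      by (rule arc_rel_rtrancl_restrict[OF _ that]) (use V 1 2 in auto)
    then show ?thesis by (simp add: arc_rel_swap[of h t] rtrancl_converse)
  qed
  show "u \<in> V1" if ne: "V1 \<noteq> {}"
  proof -
    obtain v where v: "v \<in> V1" using ne by blast
    from to_u[OF this] show ?thesis
      by (cases rule: rtranclE) (use v 1 in \<open>auto simp: arc_rel_iff\<close>)
  qed
  have bal: "card {a \<in> A1. h a = v} = card {a \<in> A1. t a = v}" if v: "v \<in> V1" "v \<noteq> u" for v
  proof -
    have "{a \<in> A1. h a = v} = {a \<in> A1 \<union> A2. h a = v}" "{a \<in> A1. t a = v} = {a \<in> A1 \<union> A2. t a = v}"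
      using v V 2 by auto
    then show ?thesis using bs v unfolding balanced_strong_def by simp
  qed
  have "card {a \<in> A1. h a = v} = card {a \<in> A1. t a = v}" if v: "v \<in> V1" for v
  proof (cases "v = u")
    case True
    \<comment> \<open>Both sums count \<open>A1\<close>, once by heads and once by tails. As all
      other terms agree, so do those at \<open>u\<close>.\<close>
    have "(\<Sum>v\<in>V1. card {a \<in> A1. h a = v}) = (\<Sum>v\<in>V1. card {a \<in> A1. t a = v})"
      using card_conv_sum_fibres[OF fin 1(1)] card_conv_sum_fibres[OF fin 1(2)] by simp
    moreover have "(\<Sum>v\<in>V1 - {u}. card {a \<in> A1. h a = v}) = (\<Sum>v\<in>V1 - {u}. card {a \<in> A1. t a = v})"
      using bal by (intro sum.cong) auto
    ultimately show ?thesis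
      using fin(2) v True by (simp add: sum.remove[of V1 u])
  qed (use bal v in blast)
  then show "balanced_strong V1 A1 t h"
    using to_u from_u unfolding balanced_strong_def by (meson rtrancl_trans)
qed

lemma balanced_strong_Un:
  assumes fin: "finite A1" "finite A2" and A: "A1 \<inter> A2 = {}"
    and 1: "t ` A1 \<subseteq> V1" "h ` A1 \<subseteq> V1" and 2: "t ` A2 \<subseteq> V2" "h ` A2 \<subseteq> V2"
    and bs1: "balanced_strong V1 A1 t h" and bs2: "balanced_strong V2 A2 t h"
    and u: "V1 \<noteq> {} \<Longrightarrow> u \<in> V1" "V2 \<noteq> {} \<Longrightarrow> u \<in> V2"
  shows "balanced_strong (V1 \<union> V2) (A1 \<union> A2) t h"
proof -
  \<comment> \<open>Stated for every vertex: outside \<open>V1\<close> both counts vanish, so in the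
    union the counts of the two sides can be added.\<close>
  have bal1: "card {a \<in> A1. h a = v} = card {a \<in> A1. t a = v}" for v
  proof (cases "v \<in> V1")
    case False
    then have "{a \<in> A1. h a = v} = {}" "{a \<in> A1. t a = v} = {}" using 1 by auto
    then show ?thesis by (simp only:)
  qed (use bs1 in \<open>auto simp: balanced_strong_def\<close>)
  have bal2: "card {a \<in> A2. h a = v} = card {a \<in> A2. t a = v}" for v
  proof (cases "v \<in> V2")
    case False
    then have "{a \<in> A2. h a = v} = {}" "{a \<in> A2. t a = v} = {}" using 2 by auto
    then show ?thesis by (simp only:)
  qed (use bs2 in \<open>auto simp: balanced_strong_def\<close>)
  have split: "card {a \<in> A1 \<union> A2. f a = v} = card {a \<in> A1. f a = v} + card {a \<in> A2. f a = v}" for f :: "'a \<Rightarrow> 'b" and v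
  proof -
    have "{a \<in> A1 \<union> A2. f a = v} = {a \<in> A1. f a = v} \<union> {a \<in> A2. f a = v}" by auto
    moreover have "{a \<in> A1. f a = v} \<inter> {a \<in> A2. f a = v} = {}" using A by auto
    ultimately show ?thesis using fin by (simp add: card_Un_disjoint)
  qed
  have to_u: "(v, u) \<in> (arc_rel t h (A1 \<union> A2))\<^sup>* \<and> (u, v) \<in> (arc_rel t h (A1 \<union> A2))\<^sup>*"
    if "v \<in> V1 \<union> V2" for v
    using that
  proof
    assume v: "v \<in> V1"
    then have "u \<in> V1" using u by blast
    then have "(v, u) \<in> (arc_rel t h A1)\<^sup>*" "(u, v) \<in> (arc_rel t h A1)\<^sup>*"
      using v bs1 unfolding balanced_strong_def by blast+
    then show ?thesis by (blast intro: arc_rel_rtrancl_mono)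
  next
    assume v: "v \<in> V2"
    then have "u \<in> V2" using u by blast
    then have "(v, u) \<in> (arc_rel t h A2)\<^sup>*" "(u, v) \<in> (arc_rel t h A2)\<^sup>*"
      using v bs2 unfolding balanced_strong_def by blast+
    then show ?thesis by (blast intro: arc_rel_rtrancl_mono)
  qed
  then show ?thesis
    unfolding balanced_strong_def split bal1 bal2 by (blast intro: rtrancl_trans)
qed

text \<open>What remains of \<open>rooted_seqs\<close> when hypergraph and order are forgotten; it
  passes to sublists.\<close>

definition rooted_uniform :: "nat \<Rightarrow> ('a set \<times> 'a) list \<Rightarrow> bool" where
  "rooted_uniform m F \<longleftrightarrow> (\<forall>(e, v)\<in>set F. finite e \<and> card e = m \<and> v \<in> e)"

lemma rooted_uniform_nth:
  "rooted_uniform m F \<Longrightarrow> i < length F \<Longrightarrow>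
     finite (fst (F ! i)) \<and> card (fst (F ! i)) = m \<and> snd (F ! i) \<in> fst (F ! i)"
  unfolding rooted_uniform_def by (metis (mono_tags, lifting) case_prod_beta nth_mem)

lemma star_graph_simps:
  "(i, w) \<in> arcs (star_graph F) \<longleftrightarrow> i < length F \<and> w \<in> fst (F ! i) \<and> w \<noteq> snd (F ! i)"
  "tail (star_graph F) a = snd (F ! fst a)" "head (star_graph F) a = snd a"
  by (auto simp: star_graph_def split: prod.splits)

lemma verts_star_graph: "verts (star_graph F) = (\<Union>i<length F. fst (F ! i))"
proof -
  have "verts (star_graph F) = (\<Union>x\<in>set F. fst x)"
    by (simp add: star_graph_def case_prod_beta)
  also have "\<dots> = (\<Union>i<length F. fst (F ! i))"
    unfolding set_conv_nth by blast
  finally show ?thesis .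
qed

lemma fin_digraph_star_graph:
  assumes "rooted_uniform m F"
  shows "fin_digraph (star_graph F)"
proof
  fix a assume a: "a \<in> arcs (star_graph F)"
  obtain i w where iw: "a = (i, w)" by (cases a)
  have "i < length F" "w \<in> fst (F ! i)" "snd (F ! i) \<in> fst (F ! i)"
    using a rooted_uniform_nth[OF assms] by (auto simp: iw star_graph_simps)
  then show "tail (star_graph F) a \<in> verts (star_graph F)" "head (star_graph F) a \<in> verts (star_graph F)"
    by (auto simp: iw star_graph_simps verts_star_graph)
next
  show fV: "finite (verts (star_graph F))"
    using rooted_uniform_nth[OF assms] by (auto simp: verts_star_graph)
  have "arcs (star_graph F) \<subseteq> {..<length F} \<times> verts (star_graph F)"
    by (auto simp: star_graph_simps verts_star_graph)
  then show "finite (arcs (star_graph F))" using fV by (auto intro: finite_subset)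
qed

text \<open>For \<open>m \<ge> 2\<close> no star is a bare root. Therefore a trail through all arcs,
  as in \<open>eulerian\<close>, also visits all vertices, as \<open>euler_trail\<close>
  demands.\<close>

lemma star_vertex_incident:
  assumes "rooted_uniform m F" "m \<ge> 2" "v \<in> verts (star_graph F)"
  shows "\<exists>a\<in>arcs (star_graph F). tail (star_graph F) a = v \<or> head (star_graph F) a = v"
proof -
  obtain i where i: "i < length F" "v \<in> fst (F ! i)" using assms(3) by (auto simp: verts_star_graph)
  show ?thesis
  proof (cases "v = snd (F ! i)")
    case False
    then show ?thesis using i by (intro bexI[of _ "(i, v)"]) (auto simp: star_graph_simps)
  next
    case True
    have "\<not> fst (F ! i) \<subseteq> {v}"
      using rooted_uniform_nth[OF assms(1) i(1)] assms(2) card_mono[of "{v}" "fst (F ! i)"] by auto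
    then obtain w where "w \<in> fst (F ! i)" "w \<noteq> v" by blast
    then show ?thesis using i True by (intro bexI[of _ "(i, w)"]) (auto simp: star_graph_simps)
  qed
qed

abbreviation star_balanced_strong :: "('a set \<times> 'a) list \<Rightarrow> bool" where
  "star_balanced_strong F \<equiv>
     balanced_strong (verts (star_graph F)) (arcs (star_graph F)) (tail (star_graph F)) (head (star_graph F))"

lemma eulerian_star_graph_iff:
  assumes F: "rooted_uniform m F" and m: "m \<ge> 2"
  shows "eulerian (star_graph F) \<longleftrightarrow> F \<noteq> [] \<and> star_balanced_strong F"
proof -
  let ?G = "star_graph F"
  interpret fin_digraph ?G by (rule fin_digraph_star_graph[OF F])
  have deg: "(\<forall>v\<in>verts ?G. in_degree ?G v = out_degree ?G v) \<longleftrightarrow>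
      (\<forall>v\<in>verts ?G. card {a \<in> arcs ?G. head ?G a = v} = card {a \<in> arcs ?G. tail ?G a = v})"
    by (simp add: in_degree_def out_degree_def in_arcs_def out_arcs_def)
  have trail_verts: "set (awalk_verts u p) = verts ?G" if tr: "trail u p u" "set p = arcs ?G" for u p
  proof -
    have aw: "awalk u p u" using tr by (simp add: trail_def)
    have "set (awalk_verts u p) = {u} \<union> tail ?G ` arcs ?G \<union> head ?G ` arcs ?G"
      using set_awalk_verts[OF aw] tr(2) by simp
    moreover have "u \<in> verts ?G" using aw by (simp add: awalk_def)
    moreover have "verts ?G \<subseteq> tail ?G ` arcs ?G \<union> head ?G ` arcs ?G"
      using star_vertex_incident[OF F m] by fast
    ultimately show ?thesis by auto
  qed
  show ?thesis
  proof
    assume "eulerian ?G"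
    then obtain u p where tr: "trail u p u" "set p = arcs ?G" by (auto simp: eulerian_def)
    then have eu: "euler_trail u p u" using trail_verts by (simp add: euler_trail_def)
    have aw: "awalk u p u" using tr by (simp add: trail_def)
    have "(v, w) \<in> (arcs_ends ?G)\<^sup>*" if "v \<in> verts ?G" "w \<in> verts ?G" for v w
    proof -
      have "v \<in> set (awalk_verts u p)" "w \<in> set (awalk_verts u p)" using that trail_verts[OF tr] by auto
      then obtain q q' where "awalk v q u" "awalk u q' w" using awalk_decomp[OF aw] by metis
      then have "v \<rightarrow>\<^sup>*\<^bsub>?G\<^esub> u" "u \<rightarrow>\<^sup>*\<^bsub>?G\<^esub> w" using reachable_awalk by blast+
      then have "v \<rightarrow>\<^sup>*\<^bsub>?G\<^esub> w" by (rule reachable_trans)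
      then show ?thesis using reachable_conv by blast
    qed
    moreover have "u \<in> verts ?G" using aw by (simp add: awalk_def)
    then have "F \<noteq> []" by (auto simp: verts_star_graph)
    ultimately show "F \<noteq> [] \<and> star_balanced_strong F"
      using closed_euler2(2)[OF eu] deg by (simp add: balanced_strong_def arcs_ends_arc_rel)
  next
    assume h: "F \<noteq> [] \<and> star_balanced_strong F"
    then have "snd (F ! 0) \<in> verts ?G" using rooted_uniform_nth[OF F, of 0] by (auto simp: verts_star_graph)
    then have "Digraph_Component.connected ?G"
      using connected_if_all_reach[of "snd (F ! 0)"] h reachable_conv'
      by (auto simp: balanced_strong_def arcs_ends_arc_rel)
    then have "\<exists>u p. euler_trail u p u"
      using closed_euler deg h by (simp add: balanced_strong_def)
    then show "eulerian ?G" by (auto simp: eulerian_def euler_trail_def)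
  qed
qed

lemma root_count_conv_filter: "root_count F v = length (filter (\<lambda>x. snd x = v) F)"
  by (simp add: root_count_def length_filter_conv_card)

lemma out_degree_star:
  assumes "rooted_uniform m F"
  shows "card {a \<in> arcs (star_graph F). tail (star_graph F) a = v} = (m - 1) * root_count F v"
proof -
  \<comment> \<open>A hypergraph made from \<open>F\<close> alone, with the full relation as order,
    so that the degree formula for \<open>rooted_seqs\<close> applies.\<close>
  let ?H = "\<lparr>hverts = verts (star_graph F), hedges = fst ` set F\<rparr>"
  have *: "finite e \<and> card e = m \<and> v \<in> e \<and> e \<subseteq> verts (star_graph F) \<and> e \<in> fst ` set F"
    if "(e, v) \<in> set F" for e v
    using assms that unfolding rooted_uniform_def star_graph_def by (auto intro: rev_image_eqI)
  have "e \<subseteq> verts (star_graph F) \<and> card e = m" if e: "e \<in> fst ` set F" for e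
  proof -
    obtain v where "(e, v) \<in> set F" using e by auto
    from *[OF this] show ?thesis by blast
  qed
  then have "uniform_hypergraph m ?H"
    using fin_digraph.finite_verts[OF fin_digraph_star_graph[OF assms]]
    unfolding uniform_hypergraph_def by simp
  moreover have "sorted_wrt (\<lambda>v w. (v, w) \<in> UNIV) (map snd F)"
    by (simp add: sorted_wrt_iff_nth_less)
  then have "F \<in> rooted_seqs UNIV (length F) ?H"
    using * unfolding rooted_seqs_def by fastforce
  ultimately have "out_degree (star_graph F) v = (m - 1) * root_count F v"
    by (rule out_degree_star_graph)
  then show ?thesis by (simp add: out_degree_def out_arcs_def)
qed

text \<open>Every vertex meets an arc, and by balance a head is also a tail. So passing through
  \<open>u\<close> amounts to having \<open>u\<close> as a root.\<close>

lemma root_count_pos_iff: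
  assumes F: "rooted_uniform m F" and m: "m \<ge> 2" and bs: "star_balanced_strong F"
  shows "root_count F v > 0 \<longleftrightarrow> v \<in> verts (star_graph F)"
proof
  assume "root_count F v > 0"
  then obtain i where "i < length F" "snd (F ! i) = v"
    by (auto simp: root_count_def card_gt_0_iff)
  then show "v \<in> verts (star_graph F)"
    using rooted_uniform_nth[OF F, of i] by (auto simp: verts_star_graph)
next
  let ?G = "star_graph F"
  interpret fin_digraph ?G by (rule fin_digraph_star_graph[OF F])
  assume v: "v \<in> verts ?G"
  obtain a where "a \<in> arcs ?G" "tail ?G a = v \<or> head ?G a = v" using star_vertex_incident[OF F m v] by blast
  then have "{a \<in> arcs ?G. tail ?G a = v} \<noteq> {} \<or> {a \<in> arcs ?G. head ?G a = v} \<noteq> {}" by blast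
  moreover have "finite {a \<in> arcs ?G. tail ?G a = v}" "finite {a \<in> arcs ?G. head ?G a = v}" by simp_all
  ultimately have "card {a \<in> arcs ?G. tail ?G a = v} \<noteq> 0 \<or> card {a \<in> arcs ?G. head ?G a = v} \<noteq> 0"
    unfolding card_eq_0_iff by blast
  moreover have "card {a \<in> arcs ?G. head ?G a = v} = card {a \<in> arcs ?G. tail ?G a = v}"
    using bs v unfolding balanced_strong_def by blast
  ultimately have "card {a \<in> arcs ?G. tail ?G a = v} > 0" by linarith
  then show "root_count F v > 0" using out_degree_star[OF F] by simp
qed

text \<open>\<open>tau\<close> uses an unspecified root; rerooting makes any vertex available, in
  particular the glueing vertex, where trees split.\<close>

lemma tau_eq:
  assumes F: "rooted_uniform m F" and bs: "star_balanced_strong F" and u: "u \<in> verts (star_graph F)"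
  shows "tau F = card (in_trees (verts (star_graph F)) (arcs (star_graph F))
                        (tail (star_graph F)) (head (star_graph F)) u)"
proof -
  let ?G = "star_graph F"
  interpret fin_digraph ?G by (rule fin_digraph_star_graph[OF F])
  have x: "(SOME x. x \<in> verts ?G) \<in> verts ?G" using u by (rule someI)
  show ?thesis
    unfolding tau_def card_arborescences[OF x]
    by (rule card_in_trees_reroot[OF _ _ _ _ _ _ x u]) (use bs in \<open>auto simp: balanced_strong_def\<close>)
qed

section \<open>Sorted interleavings\<close>

text \<open>Only the entries with the common key \<open>u\<close> may be interleaved freely.\<close>

lemma card_sorted_shuffles:
  assumes antisym: "\<And>x y. le x y \<Longrightarrow> le y x \<Longrightarrow> x = y"
    and trans: "\<And>x y z. le x y \<Longrightarrow> le y z \<Longrightarrow> le x z"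
    and total: "\<And>x y. x \<in> k ` set xs \<union> k ` set ys \<Longrightarrow> y \<in> k ` set xs \<union> k ` set ys \<Longrightarrow> le x y \<or> le y x"
    and "set xs \<inter> set ys = {}" "k ` set xs \<inter> k ` set ys \<subseteq> {u}"
    and "sorted_wrt le (map k xs)" "sorted_wrt le (map k ys)"
  shows "card {zs \<in> shuffles xs ys. sorted_wrt le (map k zs)} =
    (length (filter (\<lambda>x. k x = u) xs) + length (filter (\<lambda>x. k x = u) ys)) choose length (filter (\<lambda>x. k x = u) xs)"
    (is "card (?S xs ys) = (?n xs + ?n ys) choose ?n xs")
  using assms(3-)
proof (induction xs ys rule: shuffles.induct)
  case (1 ys)
  then have "?S [] ys = {ys}" by auto
  then show ?case by simp
next
  case (2 xs)
  then have "?S xs [] = {xs}" by auto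
  then show ?case by simp
next
  case (3 x xs y ys)
  let ?A = "(#) x ` ?S xs (y # ys)" and ?B = "(#) y ` ?S (x # xs) ys"
  have le_x: "le (k x) (k z)" if "z \<in> set xs" for z using "3.prems"(4) that by auto
  have le_y: "le (k y) (k z)" if "z \<in> set ys" for z using "3.prems"(5) that by auto
  have IH1: "card (?S xs (y # ys)) = (?n xs + ?n (y # ys)) choose ?n xs"
    using "3.prems" by (intro "3.IH"(1)) auto
  have IH2: "card (?S (x # xs) ys) = (?n (x # xs) + ?n ys) choose ?n (x # xs)"
    using "3.prems" by (intro "3.IH"(2)) auto
  have sub: "?S (x # xs) (y # ys) \<subseteq> ?A \<union> ?B" by auto
  have inA: "?A \<subseteq> ?S (x # xs) (y # ys)" if "le (k x) (k y)"
  proof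
    fix zs assume "zs \<in> ?A"
    then obtain zs' where z: "zs = x # zs'" "zs' \<in> shuffles xs (y # ys)" "sorted_wrt le (map k zs')" by auto
    have "set zs' = set xs \<union> insert y (set ys)" using set_shuffles[OF z(2)] by simp
    then have "le (k x) (k w)" if "w \<in> set zs'" for w
      using that le_x \<open>le (k x) (k y)\<close> trans[OF \<open>le (k x) (k y)\<close> le_y] by auto
    then show "zs \<in> ?S (x # xs) (y # ys)" using z by auto
  qed
  have inB: "?B \<subseteq> ?S (x # xs) (y # ys)" if "le (k y) (k x)"
  proof
    fix zs assume "zs \<in> ?B"
    then obtain zs' where z: "zs = y # zs'" "zs' \<in> shuffles (x # xs) ys" "sorted_wrt le (map k zs')" by auto
    have "set zs' = insert x (set xs) \<union> set ys" using set_shuffles[OF z(2)] by simp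
    then have "le (k y) (k w)" if "w \<in> set zs'" for w
      using that le_y \<open>le (k y) (k x)\<close> trans[OF \<open>le (k y) (k x)\<close> le_x] by auto
    then show "zs \<in> ?S (x # xs) (y # ys)" using z by auto
  qed
  have notA: "le (k x) (k y)" if "zs \<in> ?S (x # xs) (y # ys)" "zs \<in> ?A" for zs
  proof -
    from that(2) obtain zs' where z: "zs = x # zs'" "zs' \<in> shuffles xs (y # ys)" by auto
    then have "y \<in> set zs'" using set_shuffles by fastforce
    then show ?thesis using that(1) z by auto
  qed
  have notB: "le (k y) (k x)" if "zs \<in> ?S (x # xs) (y # ys)" "zs \<in> ?B" for zs
  proof -
    from that(2) obtain zs' where z: "zs = y # zs'" "zs' \<in> shuffles (x # xs) ys" by auto
    then have "x \<in> set zs'" using set_shuffles by fastforce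
    then show ?thesis using that(1) z by auto
  qed
  have fin: "finite ?A" "finite ?B" by (auto intro: finite_imageI finite_subset[OF _ finite_shuffles])
  have cA: "card ?A = card (?S xs (y # ys))" and cB: "card ?B = card (?S (x # xs) ys)"
    by (simp_all add: card_image)
  have "x \<noteq> y" using "3.prems"(2) by auto
  then have disj: "?A \<inter> ?B = {}" by auto
  have tot: "le (k x) (k y) \<or> le (k y) (k x)" using "3.prems"(1) by auto
  \<comment> \<open>In a sorted list whose first key lies strictly above \<open>u\<close>, the key
    \<open>u\<close> cannot occur later, by antisymmetry.\<close>
  have no_u_ys: "?n (y # ys) = 0" if "k y \<noteq> u" "le (k u') (k y)" "k u' = u" for u'
  proof -
    have "k z \<noteq> u" if "z \<in> set (y # ys)" for z
      using that le_y[of z] antisym \<open>k y \<noteq> u\<close> \<open>le (k u') (k y)\<close> \<open>k u' = u\<close> by auto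
    then show ?thesis by (simp add: filter_empty_conv)
  qed
  have no_u_xs: "?n (x # xs) = 0" if "k x \<noteq> u" "le (k u') (k x)" "k u' = u" for u'
  proof -
    have "k z \<noteq> u" if "z \<in> set (x # xs)" for z
      using that le_x[of z] antisym \<open>k x \<noteq> u\<close> \<open>le (k u') (k x)\<close> \<open>k u' = u\<close> by auto
    then show ?thesis by (simp add: filter_empty_conv)
  qed
  show ?case
  proof (cases "k x = k y")
    case True
    then have u: "k x = u" "k y = u" using "3.prems"(3) by auto
    \<comment> \<open>With equal keys either head may come first, and the two counts combine by
      Pascal's rule.\<close>
    have "le (k x) (k y)" "le (k y) (k x)" using tot True by simp_all
    then have "?S (x # xs) (y # ys) = ?A \<union> ?B"
      using sub inA inB by (intro equalityI Un_least)
    then have "card (?S (x # xs) (y # ys)) = card ?A + card ?B"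
      using fin disj by (simp only: card_Un_disjoint)
    also have "\<dots> = (?n (x # xs) + ?n (y # ys)) choose ?n (x # xs)"
      unfolding cA cB IH1 IH2 using u by simp
    finally show ?thesis .
  next
    case ne: False
    show ?thesis
    proof (cases "le (k x) (k y)")
      case True
      then have nle: "\<not> le (k y) (k x)" using antisym ne by blast
      have "?S (x # xs) (y # ys) = ?A"
      proof (rule equalityI[OF subsetI inA[OF True]])
        fix zs assume zs: "zs \<in> ?S (x # xs) (y # ys)"
        from subsetD[OF sub zs] show "zs \<in> ?A"
        proof (rule UnE)
          assume "zs \<in> ?B"
          from notB[OF zs this] nle show ?thesis by contradiction
        qed
      qed
      then have card: "card (?S (x # xs) (y # ys)) = (?n xs + ?n (y # ys)) choose ?n xs"
        using cA IH1 by simp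
      show ?thesis
      proof (cases "k x = u")
        case False
        then show ?thesis unfolding card by simp
      next
        case u: True
        \<comment> \<open>The entries with key \<open>u\<close> all come from \<open>x # xs\<close>,
          so the binomials before and after removing \<open>x\<close> are both of the form
          \<open>n choose n\<close>.\<close>
        then have "?n (y # ys) = 0" using no_u_ys[of x] True ne by simp
        then show ?thesis unfolding card by simp
      qed
    next
      case False
      then have le: "le (k y) (k x)" using tot by blast
      have "?S (x # xs) (y # ys) = ?B"
      proof (rule equalityI[OF subsetI inB[OF le]])
        fix zs assume zs: "zs \<in> ?S (x # xs) (y # ys)"
        from subsetD[OF sub zs] show "zs \<in> ?B"
        proof (rule UnE)
          assume "zs \<in> ?A"
          from notA[OF zs this] False show ?thesis by contradiction
        qed
      qed
      then have card: "card (?S (x # xs) (y # ys)) = (?n (x # xs) + ?n ys) choose ?n (x # xs)"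
        using cB IH2 by simp
      show ?thesis
      proof (cases "k y = u")
        case False
        then show ?thesis unfolding card by simp
      next
        case u: True
        then have "?n (x # xs) = 0" using no_u_xs[of y] le ne by simp
        then show ?thesis unfolding card by simp
      qed
    qed
  qed
qed

section \<open>Splitting a sequence at a cut vertex\<close>

lemma filter_index:
  obtains g where "inj_on g {..<length (filter P F)}"
    "g ` {..<length (filter P F)} = {i. i < length F \<and> P (F ! i)}"
    "\<And>i. i < length (filter P F) \<Longrightarrow> F ! g i = filter P F ! i"
proof -
  define L where "L = filter (\<lambda>i. P (F ! i)) [0..<length F]"
  have eq: "filter P F = map ((!) F) L"
  proof -
    have "filter P F = filter P (map ((!) F) [0..<length F])" by (simp only: map_nth)
    then show ?thesis by (simp only: filter_map L_def comp_def)
  qed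
  then have len: "length (filter P F) = length L" by simp
  show ?thesis
  proof (rule that[of "(!) L"])
    show "inj_on ((!) L) {..<length (filter P F)}"
      unfolding len by (intro inj_on_nth) (auto simp: L_def)
    have "(!) L ` {..<length L} = set L" by (auto simp: set_conv_nth)
    then show "(!) L ` {..<length (filter P F)} = {i. i < length F \<and> P (F ! i)}"
      unfolding len by (auto simp: L_def)
    show "F ! (L ! i) = filter P F ! i" if "i < length (filter P F)" for i
      using that len by (simp add: eq)
  qed
qed

text \<open>\<open>f\<close> restores the original list position of each arc and keeps its
  head.\<close>

lemma star_graph_filter:
  obtains f where "inj_on f (arcs (star_graph (filter P F)))"
    "f ` arcs (star_graph (filter P F)) = {a \<in> arcs (star_graph F). P (F ! fst a)}"
    "\<And>a. a \<in> arcs (star_graph (filter P F)) \<Longrightarrow>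
       tail (star_graph F) (f a) = tail (star_graph (filter P F)) a \<and>
       head (star_graph F) (f a) = head (star_graph (filter P F)) a"
proof -
  let ?F = "filter P F"
  obtain g where g: "inj_on g {..<length ?F}" "g ` {..<length ?F} = {i. i < length F \<and> P (F ! i)}"
    "\<And>i. i < length ?F \<Longrightarrow> F ! g i = ?F ! i" by (rule filter_index[of P F]) blast
  define f where "f = (\<lambda>(i, w :: 'a). (g i, w))"
  have f: "f a = (g (fst a), snd a)" for a by (simp add: f_def case_prod_beta)
  have A: "a \<in> arcs (star_graph E) \<longleftrightarrow> fst a < length E \<and> snd a \<in> fst (E ! fst a) \<and> snd a \<noteq> snd (E ! fst a)"
    for a and E :: "('a set \<times> 'a) list"
    using star_graph_simps(1)[of "fst a" "snd a" E] by simp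
  show ?thesis
  proof (rule that[of f])
    show "inj_on f (arcs (star_graph ?F))"
      using g(1) unfolding inj_on_def f by (auto simp: A prod_eq_iff)
    show "f ` arcs (star_graph ?F) = {a \<in> arcs (star_graph F). P (F ! fst a)}"
    proof (intro equalityI subsetI)
      fix b assume "b \<in> f ` arcs (star_graph ?F)"
      then obtain a where a: "a \<in> arcs (star_graph ?F)" "b = (g (fst a), snd a)" by (auto simp: f)
      then have l: "fst a < length ?F" by (simp add: A)
      then have "g (fst a) \<in> {i. i < length F \<and> P (F ! i)}" unfolding g(2)[symmetric] by simp
      then show "b \<in> {a \<in> arcs (star_graph F). P (F ! fst a)}"
        using a g(3)[OF l] by (simp add: A)
    next
      fix b assume b: "b \<in> {a \<in> arcs (star_graph F). P (F ! fst a)}"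
      then have "fst b \<in> g ` {..<length ?F}" unfolding g(2) by (simp add: A)
      then obtain i where i: "i < length ?F" "fst b = g i" by auto
      have "(i, snd b) \<in> arcs (star_graph ?F)" using b i g(3)[OF i(1)] by (simp add: A)
      moreover have "f (i, snd b) = b" using i(2) by (simp add: f prod_eq_iff)
      ultimately show "b \<in> f ` arcs (star_graph ?F)" by (metis image_eqI)
    qed
    show "tail (star_graph F) (f a) = tail (star_graph ?F) a \<and> head (star_graph F) (f a) = head (star_graph ?F) a"
      if "a \<in> arcs (star_graph ?F)" for a
      using that g(3) by (simp add: A f star_graph_simps)
  qed
qed

lemma balanced_strong_image:
  assumes "inj_on f A" "\<And>a. a \<in> A \<Longrightarrow> t (f a) = t' a \<and> h (f a) = h' a"
  shows "balanced_strong V (f ` A) t h \<longleftrightarrow> balanced_strong V A t' h'"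
proof -
  have "arc_rel t h (f ` A) = arc_rel t' h' A" using assms(2) by (rule arc_rel_image)
  moreover have "card {b \<in> f ` A. s b = v} = card {a \<in> A. s' a = v}"
    if "\<And>a. a \<in> A \<Longrightarrow> s (f a) = s' a" for s :: "'b \<Rightarrow> 'c" and s' v
  proof -
    have "{b \<in> f ` A. s b = v} = f ` {a \<in> A. s' a = v}" using that by force
    moreover have "inj_on f {a \<in> A. s' a = v}" using assms(1) by (rule inj_on_subset) auto
    ultimately show ?thesis by (simp add: card_image)
  qed
  from this[of t t'] this[of h h']
  have "\<And>v. card {b \<in> f ` A. t b = v} = card {a \<in> A. t' a = v}"
     "\<And>v. card {b \<in> f ` A. h b = v} = card {a \<in> A. h' a = v}"
    using assms(2) by blast+
  ultimately show ?thesis by (simp add: balanced_strong_def)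
qed

abbreviation filtered_arcs :: "(('a set \<times> 'a) \<Rightarrow> bool) \<Rightarrow> ('a set \<times> 'a) list \<Rightarrow> (nat \<times> 'a) set" where
  "filtered_arcs P F \<equiv> {a \<in> arcs (star_graph F). P (F ! fst a)}"

lemma star_balanced_strong_filter:
  "star_balanced_strong (filter P F) \<longleftrightarrow>
   balanced_strong (verts (star_graph (filter P F))) (filtered_arcs P F) (tail (star_graph F)) (head (star_graph F))"
proof -
  obtain f where f: "inj_on f (arcs (star_graph (filter P F)))"
    "f ` arcs (star_graph (filter P F)) = filtered_arcs P F"
    "\<And>a. a \<in> arcs (star_graph (filter P F)) \<Longrightarrow>
       tail (star_graph F) (f a) = tail (star_graph (filter P F)) a \<and>
       head (star_graph F) (f a) = head (star_graph (filter P F)) a"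
    by (rule star_graph_filter[of P F]) blast
  show ?thesis
    unfolding f(2)[symmetric] by (rule balanced_strong_image[OF f(1), symmetric]) (rule f(3))
qed

lemma card_in_trees_filter:
  "card (in_trees V (arcs (star_graph (filter P F))) (tail (star_graph (filter P F))) (head (star_graph (filter P F))) x) =
   card (in_trees V (filtered_arcs P F) (tail (star_graph F)) (head (star_graph F)) x)"
proof -
  obtain f where f: "inj_on f (arcs (star_graph (filter P F)))"
    "f ` arcs (star_graph (filter P F)) = filtered_arcs P F"
    "\<And>a. a \<in> arcs (star_graph (filter P F)) \<Longrightarrow>
       tail (star_graph F) (f a) = tail (star_graph (filter P F)) a \<and>
       head (star_graph F) (f a) = head (star_graph (filter P F)) a"
    by (rule star_graph_filter[of P F]) blast
  show ?thesis
    unfolding f(2)[symmetric] by (rule card_in_trees_image[OF f(1), symmetric]) (rule f(3))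
qed

lemma verts_star_graph_set: "verts (star_graph F) = (\<Union>x\<in>set F. fst x)"
  by (simp add: star_graph_def case_prod_beta)

lemma filtered_arcs_ends:
  assumes "rooted_uniform m F"
  shows "tail (star_graph F) ` filtered_arcs P F \<subseteq> verts (star_graph (filter P F))"
    and "head (star_graph F) ` filtered_arcs P F \<subseteq> verts (star_graph (filter P F))"
proof -
  have "tail (star_graph F) a \<in> verts (star_graph (filter P F)) \<and>
        head (star_graph F) a \<in> verts (star_graph (filter P F))" if "a \<in> filtered_arcs P F" for a
  proof -
    obtain i w where a: "a = (i, w)" by (cases a)
    have i: "i < length F" "w \<in> fst (F ! i)" "P (F ! i)" using that by (auto simp: a star_graph_simps)
    then have "F ! i \<in> set (filter P F)" by simp
    moreover have "snd (F ! i) \<in> fst (F ! i)" using rooted_uniform_nth[OF assms i(1)] by simp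
    ultimately show ?thesis
      using i(2) unfolding verts_star_graph_set a star_graph_simps fst_conv snd_conv by blast
  qed
  then show "tail (star_graph F) ` filtered_arcs P F \<subseteq> verts (star_graph (filter P F))"
    and "head (star_graph F) ` filtered_arcs P F \<subseteq> verts (star_graph (filter P F))" by blast+
qed

section \<open>Closed sequences and their weights\<close>

text \<open>The sequences that may occur as a restriction; the empty one accounts for the terms with
  \<open>d_i = t_i = 0\<close>.\<close>

definition closed_at :: "'a \<Rightarrow> ('a set \<times> 'a) list \<Rightarrow> bool" where
  "closed_at u F \<longleftrightarrow> F = [] \<or> (eulerian (star_graph F) \<and> root_count F u > 0)"

text \<open>The right-hand side covers empty and nonempty sequences alike, and it is the form in
  which the parts can be joined.\<close>

lemma closed_at_iff:
  assumes F: "rooted_uniform m F" and m: "m \<ge> 2"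
  shows "closed_at u F \<longleftrightarrow>
    star_balanced_strong F \<and> (verts (star_graph F) \<noteq> {} \<longrightarrow> u \<in> verts (star_graph F))"
proof (cases "F = []")
  case True
  then have "verts (star_graph F) = {}" by (simp add: star_graph_def)
  then show ?thesis using True by (simp add: closed_at_def balanced_strong_def)
next
  case False
  then have "verts (star_graph F) \<noteq> {}"
    using rooted_uniform_nth[OF F, of 0] by (auto simp: verts_star_graph)
  then show ?thesis
    using False eulerian_star_graph_iff[OF F m] root_count_pos_iff[OF F m] by (auto simp: closed_at_def)
qed

text \<open>Inserting \<open>u\<close> gives the empty sequence exactly one tree, the empty arc
  set.\<close>

definition root_trees :: "'a \<Rightarrow> ('a set \<times> 'a) list \<Rightarrow> nat" where
  "root_trees u F = card (in_trees (insert u (verts (star_graph F))) (arcs (star_graph F))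
                            (tail (star_graph F)) (head (star_graph F)) u)"

definition other_degrees :: "nat \<Rightarrow> 'a \<Rightarrow> ('a set \<times> 'a) list \<Rightarrow> real" where
  "other_degrees m u F = (\<Prod>v\<in>verts (star_graph F) - {u}. real ((m - 1) * root_count F v))"

text \<open>The weight of a sequence without its factor for the glueing vertex; it is multiplicative
  under coalescence, and equals \<open>quot1 t d * omega\<close> (with the convention for the empty sequence).\<close>

definition weight :: "nat \<Rightarrow> nat \<Rightarrow> 'a \<Rightarrow> ('a set \<times> 'a) list \<Rightarrow> real" where
  "weight m n u F = real (m - 1) ^ (n - 1) * real (root_trees u F) / other_degrees m u F"

lemma weight_Nil: "weight m n u [] = real (m - 1) ^ (n - 1)"
proof -
  have "in_trees {u} {} (tail (star_graph [])) (head (star_graph [])) u = {{}}"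
    unfolding in_trees_def by auto
  moreover have "verts (star_graph ([] :: ('a set \<times> 'a) list)) = {}" "arcs (star_graph ([] :: ('a set \<times> 'a) list)) = {}"
    by (simp_all add: star_graph_def)
  ultimately show ?thesis by (simp add: weight_def root_trees_def other_degrees_def)
qed

text \<open>The out-degree of \<open>u\<close> is taken out of the product: its root count gives the
  denominator, and its \<open>m - 1\<close> cancels one of the \<open>n\<close> powers.\<close>

lemma omega_eq_weight:
  assumes F: "rooted_uniform m F" and m: "m \<ge> 2" and c: "closed_at u F" and ne: "F \<noteq> []" and n: "n \<ge> 1"
  shows "omega m n F = real (length F) / real (root_count F u) * weight m n u F"
proof -
  let ?G = "star_graph F"
  interpret fin_digraph ?G by (rule fin_digraph_star_graph[OF F])
  have rc: "root_count F u > 0" using c ne by (simp add: closed_at_def)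
  have bs: "star_balanced_strong F" using c closed_at_iff[OF F m] by blast
  have u: "u \<in> verts ?G" using rc root_count_pos_iff[OF F m bs] by blast
  have tau: "tau F = root_trees u F"
    using tau_eq[OF F bs u] u by (simp add: root_trees_def insert_absorb)
  have "(\<Prod>v\<in>verts ?G. real (out_degree ?G v)) = (\<Prod>v\<in>verts ?G. real ((m - 1) * root_count F v))"
    using out_degree_star[OF F] by (simp add: out_degree_def out_arcs_def)
  also have "\<dots> = real (m - 1) * real (root_count F u) * other_degrees m u F"
    using prod.remove[OF finite_verts u, of "\<lambda>v. real ((m - 1) * root_count F v)"]
    by (simp add: other_degrees_def)
  finally have deg: "(\<Prod>v\<in>verts ?G. real (out_degree ?G v)) = real (m - 1) * real (root_count F u) * other_degrees m u F" .
  define q where "q = real (m - 1)"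
  have "q ^ n = q * q ^ (n - 1)"
    using n by (cases n) auto
  moreover have "q \<noteq> 0" using m by (simp add: q_def)
  ultimately show ?thesis
    unfolding omega_def weight_def deg tau q_def[symmetric] by simp
qed

text \<open>Hypergraphs and orders are left out: the Euler condition, trees and degrees depend only
  on two classes of edges inside vertex sets that meet in \<open>u\<close>.\<close>

locale split_sequence =
  fixes m :: nat and F :: "('a set \<times> 'a) list" and P :: "'a set \<times> 'a \<Rightarrow> bool" and V1 V2 :: "'a set" and u :: 'a
  assumes F: "rooted_uniform m F" and m: "m \<ge> 2" and V: "V1 \<inter> V2 = {u}"
    and P1: "\<And>x. x \<in> set F \<Longrightarrow> P x \<Longrightarrow> fst x \<subseteq> V1"
    and P2: "\<And>x. x \<in> set F \<Longrightarrow> \<not> P x \<Longrightarrow> fst x \<subseteq> V2"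
begin

abbreviation "F1 \<equiv> filter P F"
abbreviation "F2 \<equiv> filter (\<lambda>x. \<not> P x) F"
abbreviation "A1 \<equiv> filtered_arcs P F"
abbreviation "A2 \<equiv> filtered_arcs (\<lambda>x. \<not> P x) F"
abbreviation "W1 \<equiv> verts (star_graph F1)"
abbreviation "W2 \<equiv> verts (star_graph F2)"

lemma rooted_parts: "rooted_uniform m F1" "rooted_uniform m F2"
  using F by (auto simp: rooted_uniform_def)

lemma W_Int: "W1 \<inter> W2 \<subseteq> {u}"
proof -
  have "W1 \<subseteq> V1" "W2 \<subseteq> V2" using P1 P2 unfolding verts_star_graph_set by fastforce+
  then show ?thesis using V by blast
qed

lemma W_Un: "verts (star_graph F) = W1 \<union> W2"
  unfolding verts_star_graph_set by auto

lemma A_Int: "A1 \<inter> A2 = {}"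
  by auto

lemma A_Un: "arcs (star_graph F) = A1 \<union> A2"
  by auto

lemmas A_ends = filtered_arcs_ends[OF F, of P] filtered_arcs_ends[OF F, of "\<lambda>x. \<not> P x"]

lemma finite_parts: "finite A1" "finite A2" "finite W1" "finite W2"
  using fin_digraph.finite_arcs[OF fin_digraph_star_graph[OF F]]
    fin_digraph.finite_verts[OF fin_digraph_star_graph[OF rooted_parts(1)]]
    fin_digraph.finite_verts[OF fin_digraph_star_graph[OF rooted_parts(2)]] by auto

lemma closed_at_split: "closed_at u F \<longleftrightarrow> closed_at u F1 \<and> closed_at u F2"
proof
  let ?t = "tail (star_graph F)" and ?h = "head (star_graph F)"
  have W': "W2 \<inter> W1 \<subseteq> {u}" using W_Int by auto
  {
    assume c: "closed_at u F"
    show "closed_at u F1 \<and> closed_at u F2"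
    \<comment> \<open>Without vertices \<open>F\<close> is empty. Otherwise closedness puts
      \<open>u\<close> into the union, as the splitting of balance requires.\<close>
    proof (cases "W1 \<union> W2 = {}")
      case True
      then have "F = []" using rooted_uniform_nth[OF F, of 0] W_Un by (auto simp: verts_star_graph)
      then show ?thesis by (simp add: closed_at_def)
    next
      case False
      have bs: "balanced_strong (W1 \<union> W2) (A1 \<union> A2) ?t ?h" and u: "u \<in> W1 \<union> W2"
        using c False unfolding closed_at_iff[OF F m] W_Un A_Un[symmetric] by auto
      then have bs': "balanced_strong (W2 \<union> W1) (A2 \<union> A1) ?t ?h" and u': "u \<in> W2 \<union> W1"
        by (simp_all add: Un_commute)
      note 1 = balanced_strong_part[OF finite_parts(1,3) W_Int A_ends bs u]
      note 2 = balanced_strong_part[OF finite_parts(2,4) W' A_ends(3,4,1,2) bs' u']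
      show ?thesis
        unfolding closed_at_iff[OF rooted_parts(1) m] closed_at_iff[OF rooted_parts(2) m]
          star_balanced_strong_filter
        using 1 2 by blast
    qed
  next
    assume "closed_at u F1 \<and> closed_at u F2"
    then have "balanced_strong W1 A1 ?t ?h" "balanced_strong W2 A2 ?t ?h"
      and u: "W1 \<noteq> {} \<Longrightarrow> u \<in> W1" "W2 \<noteq> {} \<Longrightarrow> u \<in> W2"
      unfolding closed_at_iff[OF rooted_parts(1) m] closed_at_iff[OF rooted_parts(2) m]
        star_balanced_strong_filter by blast+
    then have "balanced_strong (W1 \<union> W2) (A1 \<union> A2) ?t ?h"
      by (intro balanced_strong_Un[OF finite_parts(1,2) A_Int A_ends])
    then show "closed_at u F"
      using u unfolding closed_at_iff[OF F m] W_Un A_Un[symmetric] by blast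
  }
qed

lemma root_trees_split: "root_trees u F = root_trees u F1 * root_trees u F2"
proof -
  \<comment> \<open>Inserting \<open>u\<close> makes the intersection exactly \<open>{u}\<close>
    even if one part is empty.\<close>
  have "insert u W1 \<inter> insert u W2 = {u}" using W_Int by auto
  then have "card (in_trees (insert u W1 \<union> insert u W2) (A1 \<union> A2) (tail (star_graph F)) (head (star_graph F)) u) =
    card (in_trees (insert u W1) A1 (tail (star_graph F)) (head (star_graph F)) u) *
    card (in_trees (insert u W2) A2 (tail (star_graph F)) (head (star_graph F)) u)"
    by (rule card_in_trees_Un[OF _ A_Int]) (use A_ends in blast)+
  moreover have "insert u W1 \<union> insert u W2 = insert u (verts (star_graph F))" using W_Un by auto
  ultimately show ?thesis
    unfolding root_trees_def card_in_trees_filter A_Un[symmetric] by simp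
qed

lemma root_count_split: "root_count F v = root_count F1 v + root_count F2 v"
  unfolding root_count_conv_filter
  using sum_length_filter_compl[of P "filter (\<lambda>x. snd x = v) F"]
  by (simp add: conj_commute)

lemma root_count_eq_0:
  assumes "rooted_uniform m E" "v \<notin> verts (star_graph E)"
  shows "root_count E v = 0"
proof -
  have "{i. i < length E \<and> snd (E ! i) = v} = {}"
    using rooted_uniform_nth[OF assms(1)] assms(2) by (auto simp: verts_star_graph)
  then show ?thesis by (simp only: root_count_def card.empty)
qed

text \<open>A vertex other than \<open>u\<close> lies in one part only, so it is never a root in the
  other part and keeps its root count.\<close>

lemma other_degrees_split: "other_degrees m u F = other_degrees m u F1 * other_degrees m u F2"
proof -
  have "verts (star_graph F) - {u} = (W1 - {u}) \<union> (W2 - {u})" using W_Un by auto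
  moreover have "(W1 - {u}) \<inter> (W2 - {u}) = {}" using W_Int by auto
  ultimately have "other_degrees m u F = (\<Prod>v\<in>W1 - {u}. real ((m - 1) * root_count F v)) *
      (\<Prod>v\<in>W2 - {u}. real ((m - 1) * root_count F v))"
    unfolding other_degrees_def using finite_parts(3,4) by (simp add: prod.union_disjoint)
  also have "(\<Prod>v\<in>W1 - {u}. real ((m - 1) * root_count F v)) = other_degrees m u F1"
    unfolding other_degrees_def
  proof (rule prod.cong[OF refl])
    fix v assume "v \<in> W1 - {u}"
    then have "root_count F2 v = 0" using W_Int by (intro root_count_eq_0[OF rooted_parts(2)]) auto
    then show "real ((m - 1) * root_count F v) = real ((m - 1) * root_count F1 v)"
      by (simp only: root_count_split add_0_left add_0_right)
  qed
  also have "(\<Prod>v\<in>W2 - {u}. real ((m - 1) * root_count F v)) = other_degrees m u F2"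
    unfolding other_degrees_def
  proof (rule prod.cong[OF refl])
    fix v assume "v \<in> W2 - {u}"
    then have "root_count F1 v = 0" using W_Int by (intro root_count_eq_0[OF rooted_parts(1)]) auto
    then show "real ((m - 1) * root_count F v) = real ((m - 1) * root_count F2 v)"
      by (simp only: root_count_split add_0_left add_0_right)
  qed
  finally show ?thesis .
qed

lemma weight_split:
  assumes "n1 \<ge> 1" "n2 \<ge> 1"
  shows "weight m (n1 + n2 - 1) u F = weight m n1 u F1 * weight m n2 u F2"
proof -
  have "n1 + n2 - 1 - 1 = (n1 - 1) + (n2 - 1)" using assms by simp
  then show ?thesis
    unfolding weight_def root_trees_split other_degrees_split by (simp add: power_add)
qed

end

section \<open>Traces of a coalescence\<close>

lemma sorted_wrt_Restr:
  assumes "set xs \<subseteq> S"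
  shows "sorted_wrt (\<lambda>v w. (v, w) \<in> Restr r S) xs \<longleftrightarrow> sorted_wrt (\<lambda>v w. (v, w) \<in> r) xs"
  using assms by (induction xs) auto

lemma finite_rooted_seqs:
  assumes "uniform_hypergraph m H"
  shows "finite (rooted_seqs r d H)"
proof -
  have "finite (hverts H)" "hedges H \<subseteq> Pow (hverts H)" using assms by (auto simp: uniform_hypergraph_def)
  then have "finite (hedges H \<times> hverts H)" by (auto intro: finite_subset)
  moreover have "rooted_seqs r d H \<subseteq> {F. set F \<subseteq> hedges H \<times> hverts H \<and> length F = d}"
    using assms by (fastforce simp: rooted_seqs_def uniform_hypergraph_def)
  ultimately show ?thesis using finite_lists_length_eq finite_subset by blast
qed

lemma rooted_seqs_rooted_uniform:
  assumes "uniform_hypergraph m H" "F \<in> rooted_seqs r d H"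
  shows "rooted_uniform m F"
proof -
  have "finite e \<and> card e = m \<and> v \<in> e" if "(e, v) \<in> set F" for e v
  proof -
    have "e \<in> hedges H" "v \<in> e" using assms(2) that by (auto simp: rooted_seqs_def)
    then show ?thesis using assms(1) finite_subset unfolding uniform_hypergraph_def by blast
  qed
  then show ?thesis unfolding rooted_uniform_def by blast
qed

definition closed_seqs :: "('a \<times> 'a) set \<Rightarrow> nat \<Rightarrow> nat \<Rightarrow> 'a hypergraph \<Rightarrow> 'a \<Rightarrow> ('a set \<times> 'a) list set" where
  "closed_seqs r d t H u = {F \<in> rooted_seqs r d H. closed_at u F \<and> root_count F u = t}"

text \<open>The factor \<open>t / d\<close> cancels the \<open>d / t\<close> by which
  \<open>omega\<close> exceeds \<open>weight\<close>. On the right-hand side the conventions become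
  ordinary cases.\<close>

lemma quot1_Tr_at:
  assumes H: "uniform_hypergraph m H" and m: "m \<ge> 2" and n: "card (hverts H) \<ge> 1" and t: "t \<le> d"
  shows "quot1 t d * Tr_at m r d t H u = (\<Sum>F\<in>closed_seqs r d t H u. weight m (card (hverts H)) u F)"
proof -
  consider "d = 0" "t = 0" | "t = 0" "d > 0" | "t > 0" "d > 0" using t by linarith
  then show ?thesis
  proof cases
    case 1
    have "closed_seqs r 0 0 H u = {[]}"
      by (auto simp: closed_seqs_def rooted_seqs_def closed_at_def root_count_def)
    then show ?thesis using 1 by (simp add: quot1_def Tr_at_def weight_Nil)
  next
    case 2
    \<comment> \<open>A nonempty closed sequence has \<open>u\<close> among its roots. On the left
      it is the quotient that vanishes; \<open>Tr_at\<close> need not.\<close>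
    then have "closed_seqs r d t H u = {}"
      by (auto simp: closed_seqs_def rooted_seqs_def closed_at_def)
    then show ?thesis using 2 by (simp add: quot1_def)
  next
    case 3
    have eq: "{F \<in> eulerian_seqs r d H. root_count F u = t} = closed_seqs r d t H u"
      using 3 by (auto simp: closed_seqs_def eulerian_seqs_def rooted_seqs_def closed_at_def)
    have "omega m (card (hverts H)) F = real d / real t * weight m (card (hverts H)) u F"
      if F: "F \<in> closed_seqs r d t H u" for F
    proof -
      have "F \<noteq> []" "length F = d" "root_count F u = t" "closed_at u F" "rooted_uniform m F"
        using F 3 rooted_seqs_rooted_uniform[OF H] by (auto simp: closed_seqs_def rooted_seqs_def)
      then show ?thesis using omega_eq_weight[of m F u] m n by simp
    qed
    then have "Tr_at m r d t H u = (\<Sum>F\<in>closed_seqs r d t H u. real d / real t * weight m (card (hverts H)) u F)"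
      using 3 unfolding Tr_at_def eq by simp
    also have "\<dots> = real d / real t * (\<Sum>F\<in>closed_seqs r d t H u. weight m (card (hverts H)) u F)"
      by (simp only: sum_distrib_left)
    finally show ?thesis using 3 by (simp add: quot1_def)
  qed
qed

text \<open>The copies inside the coalescence literally share \<open>u\<close>, so the counting
  proceeds without renaming.\<close>

locale glued_hypergraphs =
  fixes m :: nat and K1 K2 H :: "'a hypergraph" and u :: 'a and r r1 r2 :: "('a \<times> 'a) set"
  assumes m: "m \<ge> 2" and K1: "uniform_hypergraph m K1" and K2: "uniform_hypergraph m K2"
    and Int: "hverts K1 \<inter> hverts K2 = {u}"
    and H: "H = \<lparr>hverts = hverts K1 \<union> hverts K2, hedges = hedges K1 \<union> hedges K2\<rparr>"
    and r: "linear_order_on (hverts H) r"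
    and r1: "r1 = Restr r (hverts K1)" and r2: "r2 = Restr r (hverts K2)"
begin

definition "in_K1 x \<longleftrightarrow> fst x \<in> hedges K1"

abbreviation "part1 F \<equiv> filter in_K1 F"
abbreviation "part2 F \<equiv> filter (\<lambda>x. \<not> in_K1 x) F"

text \<open>A common edge would lie in \<open>{u}\<close>, too small for \<open>m \<ge> 2\<close>
  vertices. Hence the edge alone decides to which side an entry belongs.\<close>

lemma edges_disjoint: "hedges K1 \<inter> hedges K2 = {}"
proof -
  have False if "e \<in> hedges K1" "e \<in> hedges K2" for e
  proof -
    have "e \<subseteq> hverts K1 \<inter> hverts K2" "card e = m"
      using that K1 K2 unfolding uniform_hypergraph_def by blast+
    then show False using m card_mono[of "{u}" e] unfolding Int by simp
  qed
  then show ?thesis by blast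
qed

lemma uniform_H: "uniform_hypergraph m H"
  using K1 K2 by (auto simp: uniform_hypergraph_def H)

lemma edge_subset: "e \<in> hedges K1 \<Longrightarrow> e \<subseteq> hverts K1" "e \<in> hedges K2 \<Longrightarrow> e \<subseteq> hverts K2"
  using K1 K2 by (auto simp: uniform_hypergraph_def)

lemma split_sequence:
  assumes "F \<in> rooted_seqs r d H"
  shows "split_sequence m F in_K1 (hverts K1) (hverts K2) u"
proof
  show "rooted_uniform m F" using rooted_seqs_rooted_uniform[OF uniform_H assms] .
  show "fst x \<subseteq> hverts K1" if "in_K1 x" for x
    using that edge_subset by (auto simp: in_K1_def)
  show "fst x \<subseteq> hverts K2" if "x \<in> set F" "\<not> in_K1 x" for x
    using that assms edge_subset(2)[of "fst x"] by (fastforce simp: in_K1_def rooted_seqs_def H)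
qed (use m Int in auto)

lemma part_rooted_seqs:
  assumes F: "F \<in> rooted_seqs r d H"
  shows "part1 F \<in> rooted_seqs r1 (length (part1 F)) K1" "part2 F \<in> rooted_seqs r2 (length (part2 F)) K2"
proof -
  have s: "sorted_wrt (\<lambda>v w. (v, w) \<in> r) (map snd F)"
    and e: "\<And>e v. (e, v) \<in> set F \<Longrightarrow> e \<in> hedges H \<and> v \<in> e"
    using F by (auto simp: rooted_seqs_def)
  have s': "sorted_wrt (\<lambda>v w. (v, w) \<in> r) (map snd (filter Q F))" for Q
    using s by (simp add: sorted_wrt_map sorted_wrt_filter)
  have e1: "e \<in> hedges K1 \<and> v \<in> e" if "(e, v) \<in> set (part1 F)" for e v
    using that e[of e v] by (auto simp: in_K1_def)
  have e2: "e \<in> hedges K2 \<and> v \<in> e" if "(e, v) \<in> set (part2 F)" for e v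
    using that e[of e v] by (auto simp: in_K1_def H)
  have "snd ` set (part1 F) \<subseteq> hverts K1"
    using e1 edge_subset(1) by fastforce
  moreover have "snd ` set (part2 F) \<subseteq> hverts K2"
    using e2 edge_subset(2) by fastforce
  ultimately show "part1 F \<in> rooted_seqs r1 (length (part1 F)) K1" "part2 F \<in> rooted_seqs r2 (length (part2 F)) K2"
    using e1 e2 s' sorted_wrt_Restr[of "map snd (part1 F)" "hverts K1" r]
       sorted_wrt_Restr[of "map snd (part2 F)" "hverts K2" r]
    unfolding rooted_seqs_def r1 r2 by auto
qed

lemma card_fibre:
  assumes F1: "F1 \<in> rooted_seqs r1 d1 K1" and F2: "F2 \<in> rooted_seqs r2 d2 K2"
  shows "card {F \<in> rooted_seqs r (d1 + d2) H. part1 F = F1 \<and> part2 F = F2} =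
    (root_count F1 u + root_count F2 u) choose root_count F1 u"
proof -
  have e1: "e \<in> hedges K1 \<and> v \<in> e" if "(e, v) \<in> set F1" for e v
    using that F1 by (auto simp: rooted_seqs_def)
  have e2: "e \<in> hedges K2 \<and> v \<in> e" if "(e, v) \<in> set F2" for e v
    using that F2 by (auto simp: rooted_seqs_def)
  have sep: "\<And>x. x \<in> set F1 \<Longrightarrow> in_K1 x" "\<And>x. x \<in> set F2 \<Longrightarrow> \<not> in_K1 x"
    using e1 e2 edges_disjoint by (fastforce simp: in_K1_def)+
  have v1: "snd ` set F1 \<subseteq> hverts K1" using e1 edge_subset(1) by fastforce
  have v2: "snd ` set F2 \<subseteq> hverts K2" using e2 edge_subset(2) by fastforce
  have s1: "sorted_wrt (\<lambda>v w. (v, w) \<in> r) (map snd F1)"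
    using F1 sorted_wrt_Restr[of "map snd F1" "hverts K1" r] v1 by (simp add: rooted_seqs_def r1)
  have s2: "sorted_wrt (\<lambda>v w. (v, w) \<in> r) (map snd F2)"
    using F2 sorted_wrt_Restr[of "map snd F2" "hverts K2" r] v2 by (simp add: rooted_seqs_def r2)
  \<comment> \<open>Since the predicate separates \<open>F1\<close> from \<open>F2\<close>, the
    lists with these two filters are exactly their shuffles; edges and roots are inherited, so
    sortedness is the one condition left.\<close>
  have "part1 F = F1 \<and> part2 F = F2 \<longleftrightarrow> F \<in> shuffles F1 F2" for F
    using inv_image_partition[of F1 in_K1 F2] sep by (auto simp: vimage_def comp_def)
  moreover have "F \<in> rooted_seqs r (d1 + d2) H \<longleftrightarrow> sorted_wrt (\<lambda>v w. (v, w) \<in> r) (map snd F)"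
    if sh: "F \<in> shuffles F1 F2" for F
  proof -
    have "length F = d1 + d2"
      using length_shuffles[OF sh] F1 F2 by (simp add: rooted_seqs_def)
    moreover have "e \<in> hedges H \<and> v \<in> e" if "(e, v) \<in> set F" for e v
      using that set_shuffles[OF sh] e1[of e v] e2[of e v] by (auto simp: H)
    ultimately show ?thesis unfolding rooted_seqs_def by blast
  qed
  ultimately have "{F \<in> rooted_seqs r (d1 + d2) H. part1 F = F1 \<and> part2 F = F2} =
      {F \<in> shuffles F1 F2. sorted_wrt (\<lambda>v w. (v, w) \<in> r) (map snd F)}" by blast
  also have "card \<dots> = (length (filter (\<lambda>x. snd x = u) F1) + length (filter (\<lambda>x. snd x = u) F2)) choose
      length (filter (\<lambda>x. snd x = u) F1)"
  proof (rule card_sorted_shuffles[OF _ _ _ _ _ s1 s2])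
    show "x = y" if "(x, y) \<in> r" "(y, x) \<in> r" for x y
      using r that by (auto simp: order_on_defs antisym_def)
    show "(x, z) \<in> r" if "(x, y) \<in> r" "(y, z) \<in> r" for x y z
      using r that by (auto simp: order_on_defs elim: transE)
    show "(x, y) \<in> r \<or> (y, x) \<in> r"
      if "x \<in> snd ` set F1 \<union> snd ` set F2" "y \<in> snd ` set F1 \<union> snd ` set F2" for x y
    proof -
      have "x \<in> hverts H" "y \<in> hverts H" using that v1 v2 by (auto simp: H)
      then show ?thesis using r by (cases "x = y") (auto simp: order_on_defs total_on_def refl_on_def)
    qed
    show "set F1 \<inter> set F2 = {}" using sep by blast
    show "snd ` set F1 \<inter> snd ` set F2 \<subseteq> {u}" using v1 v2 Int by blast
  qed
  finally show ?thesis by (simp add: root_count_conv_filter)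
qed

lemma finite_closed_seqs: "finite (closed_seqs r1 d t K1 u)" "finite (closed_seqs r2 d t K2 u)"
  using finite_rooted_seqs[OF K1] finite_rooted_seqs[OF K2] by (auto simp: closed_seqs_def)

lemma Tr_glued:
  assumes d: "d > 0"
  shows "Tr m r d H u =
    (\<Sum>(d1, d2) \<in> {(d1, d2). d1 + d2 = d}.
      \<Sum>(t1, t2) \<in> {(t1, t2). t1 \<le> d1 \<and> t2 \<le> d2 \<and> 0 < t1 + t2}.
        real d / real (t1 + t2) * real ((t1 + t2) choose t1) *
        quot1 t1 d1 * Tr_at m r1 d1 t1 K1 u *
        quot1 t2 d2 * Tr_at m r2 d2 t2 K2 u)"
proof -
  define n1 n2 where "n1 = card (hverts K1)" and "n2 = card (hverts K2)"
  have fin: "finite (hverts K1)" "finite (hverts K2)" using K1 K2 by (auto simp: uniform_hypergraph_def)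
  have n: "n1 \<ge> 1" "n2 \<ge> 1" using fin Int by (auto simp: n1_def n2_def Suc_le_eq card_gt_0_iff)
  have cardH: "card (hverts H) = n1 + n2 - 1"
    using card_Un_Int[OF fin] Int by (simp add: H n1_def n2_def)
  define Y where "Y = {F \<in> rooted_seqs r d H. closed_at u F}"
  define W where "W F = weight m n1 u (part1 F) * weight m n2 u (part2 F)" for F
  \<comment> \<open>The four summation indices of the right-hand side, read off from
    \<open>F\<close>.\<close>
  define key where "key F = ((length (part1 F), length (part2 F)), (root_count (part1 F) u, root_count (part2 F) u))" for F
  define D where "D = {(d1, d2). d1 + d2 = d}"
  define T where "T q = {(t1, t2). t1 \<le> fst q \<and> t2 \<le> snd q \<and> 0 < t1 + t2}" for q :: "nat \<times> nat"
  have finD: "finite D"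
    by (rule finite_subset[of _ "{..d} \<times> {..d}"]) (auto simp: D_def)
  have finT: "finite (T q)" for q
    by (rule finite_subset[of _ "{..fst q} \<times> {..snd q}"]) (auto simp: T_def)
  have finY: "finite Y" using finite_rooted_seqs[OF uniform_H] by (simp add: Y_def)
  have lenF: "length F = d" "F \<noteq> []" if "F \<in> Y" for F
    using that d by (auto simp: Y_def rooted_seqs_def)
  have split: "split_sequence m F in_K1 (hverts K1) (hverts K2) u" if "F \<in> Y" for F
    using that split_sequence[of F d] by (simp add: Y_def)
  have rc: "root_count F u = root_count (part1 F) u + root_count (part2 F) u" if "F \<in> Y" for F
    using split_sequence.root_count_split[OF split[OF that]] .
  have "key ` Y \<subseteq> Sigma D T"
  proof (rule image_subsetI)
    fix F assume Y: "F \<in> Y"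
    have "length (part1 F) + length (part2 F) = d"
      using sum_length_filter_compl[of in_K1 F] lenF[OF Y] by simp
    moreover have "root_count E u \<le> length E" for E by (simp add: root_count_conv_filter)
    moreover have "root_count F u > 0" using Y lenF(2)[OF Y] by (simp add: Y_def closed_at_def)
    ultimately show "key F \<in> Sigma D T" using rc[OF Y] by (simp add: key_def D_def T_def)
  qed
  note group1 = sum.group[OF finY _ this, symmetric]
  \<comment> \<open>As \<open>d > 0\<close>, the empty sequence, which is closed but not Eulerian,
    does not interfere.\<close>
  have "{F \<in> eulerian_seqs r d H. root_count F u > 0} = Y"
    using lenF(2) d by (auto simp: Y_def eulerian_seqs_def closed_at_def rooted_seqs_def)
  then have "Tr m r d H u = (\<Sum>F\<in>Y. omega m (n1 + n2 - 1) F)"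
    by (simp add: Tr_def cardH)
  also have "\<dots> = (\<Sum>F\<in>Y. real d / real (root_count F u) * W F)"
  proof (rule sum.cong[OF refl])
    fix F assume Y: "F \<in> Y"
    have "rooted_uniform m F" "closed_at u F"
      using Y rooted_seqs_rooted_uniform[OF uniform_H] by (auto simp: Y_def)
    then have "omega m (n1 + n2 - 1) F = real d / real (root_count F u) * weight m (n1 + n2 - 1) u F"
      using omega_eq_weight[of m F u "n1 + n2 - 1"] m n lenF[OF Y] by simp
    then show "omega m (n1 + n2 - 1) F = real d / real (root_count F u) * W F"
      using split_sequence.weight_split[OF split[OF Y] n] by (simp only: W_def)
  qed
  also have "\<dots> = (\<Sum>k\<in>Sigma D T. \<Sum>F | F \<in> Y \<and> key F = k. real d / real (root_count F u) * W F)"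
    by (rule group1) (use finD finT in auto)
  also have "\<dots> = (\<Sum>q\<in>D. \<Sum>s\<in>T q. \<Sum>F | F \<in> Y \<and> key F = (q, s). real d / real (root_count F u) * W F)"
    using sum.Sigma[of D T "\<lambda>q s. \<Sum>F | F \<in> Y \<and> key F = (q, s). real d / real (root_count F u) * W F"]
      finD finT by (simp add: case_prod_beta)
  also have "\<dots> = (\<Sum>(d1, d2)\<in>D. \<Sum>(t1, t2)\<in>T (d1, d2).
        real d / real (t1 + t2) * real ((t1 + t2) choose t1) *
        quot1 t1 d1 * Tr_at m r1 d1 t1 K1 u * quot1 t2 d2 * Tr_at m r2 d2 t2 K2 u)"
  proof -
    have "(\<Sum>F | F \<in> Y \<and> key F = ((d1, d2), (t1, t2)). real d / real (root_count F u) * W F) =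
        real d / real (t1 + t2) * real ((t1 + t2) choose t1) *
        quot1 t1 d1 * Tr_at m r1 d1 t1 K1 u * quot1 t2 d2 * Tr_at m r2 d2 t2 K2 u"
      if q: "(d1, d2) \<in> D" and s: "(t1, t2) \<in> T (d1, d2)" for d1 d2 t1 t2
    proof -
      let ?Z = "{F \<in> Y. key F = ((d1, d2), (t1, t2))}"
      let ?X1 = "closed_seqs r1 d1 t1 K1 u" and ?X2 = "closed_seqs r2 d2 t2 K2 u"
      let ?p = "\<lambda>F. (part1 F, part2 F)"
      have dd: "d1 + d2 = d" using q by (simp add: D_def)
      have p: "?p ` ?Z \<subseteq> ?X1 \<times> ?X2"
      proof (rule image_subsetI)
        fix F assume F: "F \<in> ?Z"
        then have "closed_at u (part1 F)" "closed_at u (part2 F)"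
          using split_sequence.closed_at_split[OF split, of F] by (auto simp: Y_def)
        then show "?p F \<in> ?X1 \<times> ?X2"
          using F part_rooted_seqs[of F d] by (auto simp: Y_def key_def closed_seqs_def)
      qed
      \<comment> \<open>Closedness of a recombined sequence is automatic, since it is equivalent to
        closedness of its parts.\<close>
      have fibre: "{F. F \<in> ?Z \<and> ?p F = (E1, E2)} = {F \<in> rooted_seqs r (d1 + d2) H. part1 F = E1 \<and> part2 F = E2}"
        if E: "(E1, E2) \<in> ?X1 \<times> ?X2" for E1 E2
      proof -
        have "closed_at u E1" "closed_at u E2" "length E1 = d1" "length E2 = d2" "root_count E1 u = t1" "root_count E2 u = t2"
          using E by (auto simp: closed_seqs_def rooted_seqs_def)
        then show ?thesis
          using split_sequence.closed_at_split[OF split_sequence] dd by (auto simp: Y_def key_def)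
      qed
      have "(\<Sum>F\<in>?Z. real d / real (root_count F u) * W F) = (\<Sum>F\<in>?Z. real d / real (t1 + t2) * W F)"
        by (rule sum.cong[OF refl]) (use rc in \<open>auto simp: key_def\<close>)
      also have "\<dots> = real d / real (t1 + t2) * (\<Sum>F\<in>?Z. W F)"
        by (simp only: sum_distrib_left)
      \<comment> \<open>A second grouping, by the pair of parts: \<open>W\<close> is constant on
        each group, so the group contributes its size, the binomial coefficient.\<close>
      also have "(\<Sum>F\<in>?Z. W F) = (\<Sum>E\<in>?X1 \<times> ?X2. \<Sum>F | F \<in> ?Z \<and> ?p F = E. W F)"
        by (rule sum.group[OF _ _ p, symmetric]) (use finY finite_closed_seqs in auto)
      also have "\<dots> = (\<Sum>(E1, E2)\<in>?X1 \<times> ?X2. real ((t1 + t2) choose t1) * (weight m n1 u E1 * weight m n2 u E2))"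
      proof (rule sum.cong[OF refl], clarify)
        fix E1 E2 assume E: "E1 \<in> ?X1" "E2 \<in> ?X2"
        have "(\<Sum>F | F \<in> ?Z \<and> ?p F = (E1, E2). W F) =
            (\<Sum>F | F \<in> ?Z \<and> ?p F = (E1, E2). weight m n1 u E1 * weight m n2 u E2)"
          by (rule sum.cong[OF refl]) (auto simp: W_def)
        also have "\<dots> = real (card {F. F \<in> ?Z \<and> ?p F = (E1, E2)}) * (weight m n1 u E1 * weight m n2 u E2)"
          by simp
        also have "card {F. F \<in> ?Z \<and> ?p F = (E1, E2)} = (t1 + t2) choose t1"
          using fibre[of E1 E2] card_fibre[of E1 d1 E2 d2] E by (simp add: closed_seqs_def)
        finally show "(\<Sum>F | F \<in> ?Z \<and> ?p F = (E1, E2). W F) =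
          real ((t1 + t2) choose t1) * (weight m n1 u E1 * weight m n2 u E2)" .
      qed
      also have "\<dots> = real ((t1 + t2) choose t1) * ((\<Sum>E1\<in>?X1. weight m n1 u E1) * (\<Sum>E2\<in>?X2. weight m n2 u E2))"
        unfolding sum_product sum.cartesian_product by (simp add: sum_distrib_left case_prod_beta)
      also have "(\<Sum>E1\<in>?X1. weight m n1 u E1) = quot1 t1 d1 * Tr_at m r1 d1 t1 K1 u"
        using quot1_Tr_at[OF K1 m, of t1 d1 r1 u] n s by (simp add: n1_def T_def)
      also have "(\<Sum>E2\<in>?X2. weight m n2 u E2) = quot1 t2 d2 * Tr_at m r2 d2 t2 K2 u"
        using quot1_Tr_at[OF K2 m, of t2 d2 r2 u] n s by (simp add: n2_def T_def)
      finally show ?thesis by (simp only: mult.assoc)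
    qed
    then show ?thesis by (intro sum.cong[OF refl]) (auto intro!: sum.cong)
  qed
  finally show ?thesis unfolding D_def T_def by simp
qed

end

text \<open>The renaming is injective because \<open>u\<close> can coincide with no vertex except
  \<open>v\<close>, so edges keep their size.\<close>

lemma replace_vertex_uniform:
  assumes "uniform_hypergraph m H" "u \<notin> hverts H - {v}"
  shows "uniform_hypergraph m (replace_vertex v u H)"
proof -
  have inj: "inj_on (id(v := u)) (hverts H)" using assms(2) by (auto simp: inj_on_def)
  have "card (id(v := u) ` e) = m \<and> id(v := u) ` e \<subseteq> id(v := u) ` hverts H" if "e \<in> hedges H" for e
  proof -
    have "e \<subseteq> hverts H" "card e = m" using assms(1) that by (auto simp: uniform_hypergraph_def)
    then show ?thesis using card_image[OF inj_on_subset[OF inj]] by blast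
  qed
  then show ?thesis
    using assms(1) unfolding uniform_hypergraph_def replace_vertex_def Let_def by auto
qed

lemma hverts_replace_vertex:
  assumes "v \<in> hverts H"
  shows "hverts (replace_vertex v u H) = insert u (hverts H - {v})"
  using assms by (auto simp: replace_vertex_def Let_def)

theorem lemma3p1:
  fixes m d :: nat and H1 H2 :: "'a hypergraph" and v1 v2 u :: 'a and r :: "('a \<times> 'a) set"
  assumes "m \<ge> 2"
    and "uniform_hypergraph m H1" "hconnected H1" "nontrivial H1"
    and "uniform_hypergraph m H2" "hconnected H2" "nontrivial H2"
    and "hverts H1 \<inter> hverts H2 = {}" "v1 \<in> hverts H1" "v2 \<in> hverts H2"
    and "u \<notin> (hverts H1 - {v1}) \<union> (hverts H2 - {v2})"
    and "linear_order_on (hverts (coalescence H1 v1 H2 v2 u)) r"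
    and "K1 = replace_vertex v1 u H1" "K2 = replace_vertex v2 u H2"
    and "r1 = Restr r (hverts K1)" "r2 = Restr r (hverts K2)"
    and "d > 0"
  shows "Tr m r d (coalescence H1 v1 H2 v2 u) u =
    (\<Sum>(d1, d2) \<in> {(d1, d2). d1 + d2 = d}.
      \<Sum>(t1, t2) \<in> {(t1, t2). t1 \<le> d1 \<and> t2 \<le> d2 \<and> 0 < t1 + t2}.
        real d / real (t1 + t2) * real ((t1 + t2) choose t1) *
        quot1 t1 d1 * Tr_at m r1 d1 t1 K1 u *
        quot1 t2 d2 * Tr_at m r2 d2 t2 K2 u)"
proof -
  \<comment> \<open>Disjointness of the originals and freshness of \<open>u\<close> leave
    \<open>u\<close> as the only common vertex of the copies.\<close>
  have "hverts K1 \<inter> hverts K2 = {u}"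
    using assms(8-11) unfolding assms(13,14) by (auto simp: hverts_replace_vertex)
  then interpret glued_hypergraphs m K1 K2 "coalescence H1 v1 H2 v2 u" u r r1 r2
    using assms by unfold_locales (auto simp: coalescence_def intro!: replace_vertex_uniform)
  show ?thesis using assms(17) by (rule Tr_glued)
qed

end
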